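(* Let $\mathcal{A}$ be an AB3 abelian category and let $\mathcal{U}$ be a set of objects of $\mathcal{A}$. Denote $\mathcal{B}=\operatorname{Pres}(\mathcal{U})$. Then the following are equivalent: (1) $\mathcal{B}$ is a coreflective subcategory of $\mathcal{A}$. (2) $\mathcal{B}$ is closed under taking cokernels in $\mathcal{A}$. (3) (a) $\mathcal{B}$ is closed under taking direct summands in $\mathcal{A}$; and (b) for every object $A\in\mathcal{A}$, $\frac{\operatorname{tr}^2_{\mathcal{U}}(\operatorname{Ker}\varepsilon_A)}{\operatorname{tr}_{\mathcal{U}}(\operatorname{Ker}\varepsilon_A)}=\operatorname{tr}_{\mathcal{U}}\left(\frac{\operatorname{Ker}\varepsilon_A}{\operatorname{tr}_{\mathcal{U}}(\operatorname{Ker}\varepsilon_A)}\right)$ is a direct summand of $\frac{\hat{U}_A}{\operatorname{tr}_{\mathcal{U}}(\operatorname{Ker}\varepsilon_A)}$. (4) For every object $A\in\mathcal{A}$ the following conditions hold: (a) $\frac{\hat{U}_A}{\operatorname{tr}^2_{\mathcal{U}}(\operatorname{Ker}\varepsilon_A)}\in\mathcal{B}$; and (b) $\mathcal{A}\left(U,\frac{\operatorname{Ker}\varepsilon_A}{\operatorname{tr}^2_{\mathcal{U}}(\operatorname{Ker}\varepsilon_A)}\right)=0$ for all $U\in\mathcal{U}$. In this case, if $\iota:\mathcal{B}\hookrightarrow\mathcal{A}$ is the inclusion functor, then, up to natural isomorphism, its right adjoint $q:\mathcal{A}\to\mathcal{B}$ acts on objects as $q(A)=\frac{\hat{U}_A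}{\operatorname{tr}^2_{\mathcal{U}}(\operatorname{Ker}\varepsilon_A)}$.
   Context: AB3 means cocomplete. Subcategories are full and closed under isomorphisms; $\mathcal{B}$ is coreflective if its inclusion has a right adjoint; closed under cokernels means that the cokernel in $\mathcal{A}$ of every morphism between objects of $\mathcal{B}$ is in $\mathcal{B}$. $\operatorname{Sum}(\mathcal{U})$ is the class of all (set-indexed) coproducts of objects from $\mathcal{U}$; $\operatorname{Gen}(\mathcal{U})$ is the class of epimorphic images of objects of $\operatorname{Sum}(\mathcal{U})$ ($\mathcal{U}$-generated objects); $\operatorname{Pres}(\mathcal{U})$ is the class of objects isomorphic to cokernels of morphisms between objects of $\operatorname{Sum}(\mathcal{U})$. For $A\in\mathcal{A}$, $\hat{U}_A=\coprod_{U\in\mathcal{U}}U^{(\mathcal{A}(U,A))}$ (coproduct of copies of $U$ indexed by $\mathcal{A}(U,A)$) and $\varepsilon_A:\hat{U}_A\to A$ is the canonical morphism whose component at $\alpha\in\mathcal{A}(U,A)$ is $\alpha$. The trace $\operatorname{tr}_{\mathcal{U}}(A)$ is the largest $\mathcal{U}$-generated subobject of $A$ (namely $\operatorname{Im}\varepsilon_A$), and $\operatorname{tr}^2_{\mathcal{U}}(A)\supseteq\operatorname{tr}_{\mathcal{U}}(A)$ is the subobject of $A$ defined by $\frac{\operatorname{tr}^2_{\mathcal{U}}(A)}{\operatorname{tr}_{\mathcal{U}}(A)}=\operatorname{tr}_{\mathcal{U}}\left(\frac{A}{\operatorname{tr}_{\mathcal{U}}(A)}\right)$. *)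

theory Defs
  imports "HOL-Algebra.Group"
begin

unbundle cardinal_syntax

text \<open>
  Size convention.  The distinction between sets and proper classes is rendered by an infinite
  regular cardinal \<open>\<kappa>\<close>: a collection is a set (is small) iff its cardinality is below \<open>\<kappa>\<close>.
  Taking \<open>\<kappa>\<close> strongly inaccessible gives the usual reading relative to a Grothendieck
  universe.  Since every \<open>\<kappa>\<close>-small collection is equipotent to a subset of \<open>Field \<kappa>\<close>,
  index sets and index categories may be taken over the type underlying \<open>\<kappa>\<close>.
\<close>

definition small :: "'k rel \<Rightarrow> 'i set \<Rightarrow> bool" where
  "small \<kappa> I \<longleftrightarrow> |I| <o \<kappa>"


section \<open>Categories, functors, adjunctions\<close>

record ('o, 'a) cat =
  Obj  :: "'o set"
  Arr  :: "'a set"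
  Dom  :: "'a \<Rightarrow> 'o"
  Cod  :: "'a \<Rightarrow> 'o"
  Id   :: "'o \<Rightarrow> 'a"
  Comp :: "'a \<Rightarrow> 'a \<Rightarrow> 'a"  (infixl \<open>\<cdot>\<index>\<close> 70)

definition Hom :: "('o, 'a) cat \<Rightarrow> 'o \<Rightarrow> 'o \<Rightarrow> 'a set" where
  "Hom C A B = {f \<in> Arr C. Dom C f = A \<and> Cod C f = B}"

locale category =
  fixes C :: "('o, 'a) cat" (structure)
  assumes Dom_Obj: "f \<in> Arr C \<Longrightarrow> Dom C f \<in> Obj C"
    and Cod_Obj: "f \<in> Arr C \<Longrightarrow> Cod C f \<in> Obj C"
    and Id_Hom: "A \<in> Obj C \<Longrightarrow> Id C A \<in> Hom C A A"
    and Comp_Hom: "f \<in> Hom C A B \<Longrightarrow> g \<in> Hom C B D \<Longrightarrow> g \<cdot> f \<in> Hom C A D"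
    and Id_left: "f \<in> Hom C A B \<Longrightarrow> Id C B \<cdot> f = f"
    and Id_right: "f \<in> Hom C A B \<Longrightarrow> f \<cdot> Id C A = f"
    and Comp_assoc: "f \<in> Hom C A B \<Longrightarrow> g \<in> Hom C B D \<Longrightarrow> h \<in> Hom C D E
      \<Longrightarrow> (h \<cdot> g) \<cdot> f = h \<cdot> (g \<cdot> f)"

definition locally_small :: "'k rel \<Rightarrow> ('o, 'a) cat \<Rightarrow> bool" where
  "locally_small \<kappa> C \<longleftrightarrow> (\<forall>A\<in>Obj C. \<forall>B\<in>Obj C. small \<kappa> (Hom C A B))"

definition is_mono :: "('o, 'a) cat \<Rightarrow> 'a \<Rightarrow> bool" where
  "is_mono C m \<longleftrightarrow> m \<in> Arr C \<and>
    (\<forall>X. \<forall>g\<in>Hom C X (Dom C m). \<forall>h\<in>Hom C X (Dom C m). m \<cdot>\<^bsub>C\<^esub> g = m \<cdot>\<^bsub>C\<^esub> h \<longrightarrow> g = h)"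

definition is_epi :: "('o, 'a) cat \<Rightarrow> 'a \<Rightarrow> bool" where
  "is_epi C e \<longleftrightarrow> e \<in> Arr C \<and>
    (\<forall>X. \<forall>g\<in>Hom C (Cod C e) X. \<forall>h\<in>Hom C (Cod C e) X. g \<cdot>\<^bsub>C\<^esub> e = h \<cdot>\<^bsub>C\<^esub> e \<longrightarrow> g = h)"

definition is_isomorphism :: "('o, 'a) cat \<Rightarrow> 'a \<Rightarrow> bool" where
  "is_isomorphism C f \<longleftrightarrow> f \<in> Arr C \<and>
    (\<exists>g\<in>Hom C (Cod C f) (Dom C f).
      g \<cdot>\<^bsub>C\<^esub> f = Id C (Dom C f) \<and> f \<cdot>\<^bsub>C\<^esub> g = Id C (Cod C f))"

definition isomorphic_objects :: "('o, 'a) cat \<Rightarrow> 'o \<Rightarrow> 'o \<Rightarrow> bool" where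
  "isomorphic_objects C A B \<longleftrightarrow> (\<exists>f\<in>Hom C A B. is_isomorphism C f)"

record ('o, 'a, 'p, 'b) cat_functor =
  OMap :: "'o \<Rightarrow> 'p"
  AMap :: "'a \<Rightarrow> 'b"

definition is_functor ::
  "('o, 'a) cat \<Rightarrow> ('p, 'b) cat \<Rightarrow> ('o, 'a, 'p, 'b) cat_functor \<Rightarrow> bool" where
  "is_functor C D F \<longleftrightarrow>
    (\<forall>A\<in>Obj C. OMap F A \<in> Obj D \<and> AMap F (Id C A) = Id D (OMap F A)) \<and>
    (\<forall>f\<in>Arr C. AMap F f \<in> Hom D (OMap F (Dom C f)) (OMap F (Cod C f))) \<and>
    (\<forall>f\<in>Arr C. \<forall>g\<in>Arr C. Cod C f = Dom C g \<longrightarrow>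
      AMap F (g \<cdot>\<^bsub>C\<^esub> f) = AMap F g \<cdot>\<^bsub>D\<^esub> AMap F f)"

definition naturally_isomorphic ::
  "('o, 'a) cat \<Rightarrow> ('p, 'b) cat \<Rightarrow> ('o, 'a, 'p, 'b) cat_functor \<Rightarrow>
    ('o, 'a, 'p, 'b) cat_functor \<Rightarrow> bool" where
  "naturally_isomorphic C D F G \<longleftrightarrow> (\<exists>\<eta>.
    (\<forall>A\<in>Obj C. \<eta> A \<in> Hom D (OMap F A) (OMap G A) \<and> is_isomorphism D (\<eta> A)) \<and>
    (\<forall>f\<in>Arr C. AMap G f \<cdot>\<^bsub>D\<^esub> \<eta> (Dom C f) = \<eta> (Cod C f) \<cdot>\<^bsub>D\<^esub> AMap F f))"

text \<open>\<open>right_adjoint C D F G\<close>: the functor \<open>G : D \<rightarrow> C\<close> is right adjoint to \<open>F : C \<rightarrow> D\<close>, by a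
  bijection \<open>\<Phi> X Y : D(F X, Y) \<rightarrow> C(X, G Y)\<close> natural in \<open>X\<close> and \<open>Y\<close>.\<close>

definition right_adjoint ::
  "('o, 'a) cat \<Rightarrow> ('p, 'b) cat \<Rightarrow> ('o, 'a, 'p, 'b) cat_functor \<Rightarrow>
    ('p, 'b, 'o, 'a) cat_functor \<Rightarrow> bool" where
  "right_adjoint C D F G \<longleftrightarrow> is_functor C D F \<and> is_functor D C G \<and>
    (\<exists>\<Phi>. (\<forall>X\<in>Obj C. \<forall>Y\<in>Obj D.
            bij_betw (\<Phi> X Y) (Hom D (OMap F X) Y) (Hom C X (OMap G Y))) \<and>
         (\<forall>u\<in>Arr C. \<forall>v\<in>Arr D. \<forall>f\<in>Hom D (OMap F (Cod C u)) (Dom D v).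
            \<Phi> (Dom C u) (Cod D v) (v \<cdot>\<^bsub>D\<^esub> f \<cdot>\<^bsub>D\<^esub> AMap F u)
              = AMap G v \<cdot>\<^bsub>C\<^esub> \<Phi> (Cod C u) (Dom D v) f \<cdot>\<^bsub>C\<^esub> u))"

definition full_subcat :: "('o, 'a) cat \<Rightarrow> 'o set \<Rightarrow> ('o, 'a) cat" where
  "full_subcat C B = C\<lparr>Obj := B, Arr := {f \<in> Arr C. Dom C f \<in> B \<and> Cod C f \<in> B}\<rparr>"

definition inclusion :: "('o, 'a, 'o, 'a) cat_functor" where
  "inclusion = \<lparr>OMap = (\<lambda>A. A), AMap = (\<lambda>f. f)\<rparr>"

text \<open>Full subcategories closed under isomorphisms are given by their classes of objects.\<close>

definition is_subcategory :: "('o, 'a) cat \<Rightarrow> 'o set \<Rightarrow> bool" where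
  "is_subcategory C B \<longleftrightarrow> B \<subseteq> Obj C \<and>
    (\<forall>X Y. X \<in> B \<and> isomorphic_objects C X Y \<longrightarrow> Y \<in> B)"

definition coreflective :: "('o, 'a) cat \<Rightarrow> 'o set \<Rightarrow> bool" where
  "coreflective C B \<longleftrightarrow> is_subcategory C B \<and>
    (\<exists>q. right_adjoint (full_subcat C B) C inclusion q)"


section \<open>Colimits\<close>

definition is_cocone ::
  "('j, 'b) cat \<Rightarrow> ('o, 'a) cat \<Rightarrow> ('j, 'b, 'o, 'a) cat_functor \<Rightarrow> 'o \<Rightarrow> ('j \<Rightarrow> 'a) \<Rightarrow> bool" where
  "is_cocone J C F X c \<longleftrightarrow> X \<in> Obj C \<and> (\<forall>j\<in>Obj J. c j \<in> Hom C (OMap F j) X) \<and>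
    (\<forall>u\<in>Arr J. c (Cod J u) \<cdot>\<^bsub>C\<^esub> AMap F u = c (Dom J u))"

definition is_colimit ::
  "('j, 'b) cat \<Rightarrow> ('o, 'a) cat \<Rightarrow> ('j, 'b, 'o, 'a) cat_functor \<Rightarrow> 'o \<Rightarrow> ('j \<Rightarrow> 'a) \<Rightarrow> bool" where
  "is_colimit J C F X c \<longleftrightarrow> is_cocone J C F X c \<and>
    (\<forall>Y d. is_cocone J C F Y d \<longrightarrow> (\<exists>!h. h \<in> Hom C X Y \<and> (\<forall>j\<in>Obj J. h \<cdot>\<^bsub>C\<^esub> c j = d j)))"

definition cocomplete :: "'k rel \<Rightarrow> ('o, 'a) cat \<Rightarrow> bool" where
  "cocomplete \<kappa> C \<longleftrightarrow> (\<forall>(J :: ('k, 'k) cat) F.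
    category J \<and> small \<kappa> (Obj J) \<and> small \<kappa> (Arr J) \<and> is_functor J C F \<longrightarrow>
    (\<exists>X c. is_colimit J C F X c))"

definition is_coproduct ::
  "('o, 'a) cat \<Rightarrow> 'i set \<Rightarrow> ('i \<Rightarrow> 'o) \<Rightarrow> 'o \<Rightarrow> ('i \<Rightarrow> 'a) \<Rightarrow> bool" where
  "is_coproduct C I D X c \<longleftrightarrow> X \<in> Obj C \<and> (\<forall>i\<in>I. c i \<in> Hom C (D i) X) \<and>
    (\<forall>Y\<in>Obj C. \<forall>d. (\<forall>i\<in>I. d i \<in> Hom C (D i) Y) \<longrightarrow>
      (\<exists>!h. h \<in> Hom C X Y \<and> (\<forall>i\<in>I. h \<cdot>\<^bsub>C\<^esub> c i = d i)))"


section \<open>Abelian categories\<close>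

definition is_zero_object :: "('o, 'a) cat \<Rightarrow> 'o \<Rightarrow> bool" where
  "is_zero_object C Z \<longleftrightarrow> Z \<in> Obj C \<and>
    (\<forall>A\<in>Obj C. (\<exists>!f. f \<in> Hom C A Z) \<and> (\<exists>!f. f \<in> Hom C Z A))"

definition is_zero_arrow :: "('o, 'a) cat \<Rightarrow> 'a \<Rightarrow> bool" where
  "is_zero_arrow C f \<longleftrightarrow> f \<in> Arr C \<and>
    (\<exists>Z g h. is_zero_object C Z \<and> g \<in> Hom C (Dom C f) Z \<and> h \<in> Hom C Z (Cod C f) \<and> f = h \<cdot>\<^bsub>C\<^esub> g)"

definition is_kernel :: "('o, 'a) cat \<Rightarrow> 'a \<Rightarrow> 'a \<Rightarrow> bool" where
  "is_kernel C f k \<longleftrightarrow> f \<in> Arr C \<and> k \<in> Arr C \<and> Cod C k = Dom C f \<and> is_zero_arrow C (f \<cdot>\<^bsub>C\<^esub> k) \<and>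
    (\<forall>g\<in>Arr C. Cod C g = Dom C f \<and> is_zero_arrow C (f \<cdot>\<^bsub>C\<^esub> g) \<longrightarrow>
      (\<exists>!h. h \<in> Hom C (Dom C g) (Dom C k) \<and> k \<cdot>\<^bsub>C\<^esub> h = g))"

definition is_cokernel :: "('o, 'a) cat \<Rightarrow> 'a \<Rightarrow> 'a \<Rightarrow> bool" where
  "is_cokernel C f p \<longleftrightarrow> f \<in> Arr C \<and> p \<in> Arr C \<and> Dom C p = Cod C f \<and> is_zero_arrow C (p \<cdot>\<^bsub>C\<^esub> f) \<and>
    (\<forall>g\<in>Arr C. Dom C g = Cod C f \<and> is_zero_arrow C (g \<cdot>\<^bsub>C\<^esub> f) \<longrightarrow>
      (\<exists>!h. h \<in> Hom C (Cod C p) (Cod C g) \<and> h \<cdot>\<^bsub>C\<^esub> p = g))"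

locale preadditive_category = category +
  fixes add :: "'a \<Rightarrow> 'a \<Rightarrow> 'a" and zero :: "'o \<Rightarrow> 'o \<Rightarrow> 'a"
  assumes Hom_group: "A \<in> Obj C \<Longrightarrow> B \<in> Obj C \<Longrightarrow>
      comm_group \<lparr>carrier = Hom C A B, mult = add, one = zero A B\<rparr>"
    and Comp_add_right: "f \<in> Hom C A B \<Longrightarrow> g \<in> Hom C A B \<Longrightarrow> h \<in> Hom C B D \<Longrightarrow>
      h \<cdot> add f g = add (h \<cdot> f) (h \<cdot> g)"
    and Comp_add_left: "f \<in> Hom C A B \<Longrightarrow> g \<in> Hom C B D \<Longrightarrow> h \<in> Hom C B D \<Longrightarrow>
      add g h \<cdot> f = add (g \<cdot> f) (h \<cdot> f)"

locale abelian_category = preadditive_category +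
  assumes ex_zero_object: "\<exists>Z. is_zero_object C Z"
    and ex_biproduct: "A \<in> Obj C \<Longrightarrow> B \<in> Obj C \<Longrightarrow> \<exists>X\<in>Obj C.
      \<exists>i\<in>Hom C A X. \<exists>j\<in>Hom C B X. \<exists>p\<in>Hom C X A. \<exists>q\<in>Hom C X B.
        p \<cdot> i = Id C A \<and> q \<cdot> j = Id C B \<and> add (i \<cdot> p) (j \<cdot> q) = Id C X"
    and ex_kernel: "f \<in> Arr C \<Longrightarrow> \<exists>k. is_kernel C f k"
    and ex_cokernel: "f \<in> Arr C \<Longrightarrow> \<exists>p. is_cokernel C f p"
    and mono_normal: "is_mono C m \<Longrightarrow> \<exists>f. is_kernel C f m"
    and epi_normal: "is_epi C e \<Longrightarrow> \<exists>f. is_cokernel C f e"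

definition abelian :: "('o, 'a) cat \<Rightarrow> bool" where
  "abelian C \<longleftrightarrow> (\<exists>add zero. abelian_category C add zero)"

definition AB3_abelian :: "'k rel \<Rightarrow> ('o, 'a) cat \<Rightarrow> bool" where
  "AB3_abelian \<kappa> C \<longleftrightarrow> abelian C \<and> cocomplete \<kappa> C"


section \<open>Chosen kernels and cokernels, subobjects, direct summands\<close>

text \<open>Kernels and cokernels are determined up to a unique isomorphism only; \<open>ker C f\<close> and
  \<open>coker C f\<close> are arbitrary choices of the structure arrows \<open>Ker f \<rightarrow> Dom f\<close> and
  \<open>Cod f \<rightarrow> Coker f\<close>.\<close>

definition ker :: "('o, 'a) cat \<Rightarrow> 'a \<Rightarrow> 'a" where
  "ker C f = (SOME k. is_kernel C f k)"

definition coker :: "('o, 'a) cat \<Rightarrow> 'a \<Rightarrow> 'a" where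
  "coker C f = (SOME p. is_cokernel C f p)"

text \<open>For a subobject \<open>m : S \<rightarrow> A\<close>, the quotient object \<open>A/S\<close>, with projection \<open>coker C m\<close>.\<close>

definition quot :: "('o, 'a) cat \<Rightarrow> 'a \<Rightarrow> 'o" where
  "quot C m = Cod C (coker C m)"

definition is_subobject :: "('o, 'a) cat \<Rightarrow> 'a \<Rightarrow> 'o \<Rightarrow> bool" where
  "is_subobject C m A \<longleftrightarrow> is_mono C m \<and> Cod C m = A"

definition sub_le :: "('o, 'a) cat \<Rightarrow> 'a \<Rightarrow> 'a \<Rightarrow> bool" where
  "sub_le C s t \<longleftrightarrow> (\<exists>i\<in>Hom C (Dom C s) (Dom C t). t \<cdot>\<^bsub>C\<^esub> i = s)"

definition sub_eq :: "('o, 'a) cat \<Rightarrow> 'a \<Rightarrow> 'a \<Rightarrow> bool" where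
  "sub_eq C s t \<longleftrightarrow> sub_le C s t \<and> sub_le C t s"

text \<open>For subobjects \<open>s : S \<rightarrow> A\<close> and \<open>t : T \<rightarrow> A\<close> with \<open>s \<le> t\<close>: the inclusion \<open>S \<rightarrow> T\<close>, and the
  quotient \<open>T/S\<close> as a subobject \<open>T/S \<rightarrow> A/S\<close>.\<close>

definition sub_incl :: "('o, 'a) cat \<Rightarrow> 'a \<Rightarrow> 'a \<Rightarrow> 'a" where
  "sub_incl C s t = (THE i. i \<in> Hom C (Dom C s) (Dom C t) \<and> t \<cdot>\<^bsub>C\<^esub> i = s)"

definition quot_sub :: "('o, 'a) cat \<Rightarrow> 'a \<Rightarrow> 'a \<Rightarrow> 'a" where
  "quot_sub C s t = (THE h. h \<in> Hom C (quot C (sub_incl C s t)) (quot C s) \<and>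
     h \<cdot>\<^bsub>C\<^esub> coker C (sub_incl C s t) = coker C s \<cdot>\<^bsub>C\<^esub> t)"

text \<open>\<open>i : X \<rightarrow> Y\<close> exhibits \<open>X\<close> as a direct summand of \<open>Y\<close>, i.e. \<open>Y = X \<oplus> X'\<close> with \<open>i\<close> the
  first injection.\<close>

definition is_direct_summand :: "('o, 'a) cat \<Rightarrow> 'a \<Rightarrow> bool" where
  "is_direct_summand C i \<longleftrightarrow> i \<in> Arr C \<and> (\<exists>j\<in>Arr C. Cod C j = Cod C i \<and>
    is_coproduct C (UNIV :: bool set) (\<lambda>b. Dom C (if b then i else j)) (Cod C i)
      (\<lambda>b. if b then i else j))"

definition closed_under_cokernels :: "('o, 'a) cat \<Rightarrow> 'o set \<Rightarrow> bool" where
  "closed_under_cokernels C B \<longleftrightarrow>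
    (\<forall>f p. Dom C f \<in> B \<and> Cod C f \<in> B \<and> is_cokernel C f p \<longrightarrow> Cod C p \<in> B)"

definition closed_under_summands :: "('o, 'a) cat \<Rightarrow> 'o set \<Rightarrow> bool" where
  "closed_under_summands C B \<longleftrightarrow>
    (\<forall>i. is_direct_summand C i \<and> Cod C i \<in> B \<longrightarrow> Dom C i \<in> B)"


section \<open>Generated and presented objects, traces\<close>

definition Sum :: "'k rel \<Rightarrow> ('o, 'a) cat \<Rightarrow> 'o set \<Rightarrow> 'o set" where
  "Sum \<kappa> C U = {X. \<exists>(I :: 'k set) D c. small \<kappa> I \<and> (\<forall>i\<in>I. D i \<in> U) \<and> is_coproduct C I D X c}"

definition Gen :: "'k rel \<Rightarrow> ('o, 'a) cat \<Rightarrow> 'o set \<Rightarrow> 'o set" where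
  "Gen \<kappa> C U = {X. \<exists>e. is_epi C e \<and> Dom C e \<in> Sum \<kappa> C U \<and> Cod C e = X}"

definition Pres :: "'k rel \<Rightarrow> ('o, 'a) cat \<Rightarrow> 'o set \<Rightarrow> 'o set" where
  "Pres \<kappa> C U = {X. \<exists>f p. Dom C f \<in> Sum \<kappa> C U \<and> Cod C f \<in> Sum \<kappa> C U \<and>
     is_cokernel C f p \<and> isomorphic_objects C (Cod C p) X}"

text \<open>The coproduct \<open>\<Coprod>\<^bsub>X \<in> U\<^esub> X\<^bsup>(Hom(X,A))\<^esup>\<close> is indexed by the pairs \<open>(X, \<alpha>)\<close> with \<open>X \<in> U\<close> and
  \<open>\<alpha> \<in> Hom(X, A)\<close>; \<open>U_hat_cop\<close> is a choice of the object together with its injections.\<close>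

definition U_hat_cop :: "('o, 'a) cat \<Rightarrow> 'o set \<Rightarrow> 'o \<Rightarrow> 'o \<times> ('o \<times> 'a \<Rightarrow> 'a)" where
  "U_hat_cop C U A = (SOME (X, c). is_coproduct C (SIGMA X:U. Hom C X A) fst X c)"

definition U_hat :: "('o, 'a) cat \<Rightarrow> 'o set \<Rightarrow> 'o \<Rightarrow> 'o" where
  "U_hat C U A = fst (U_hat_cop C U A)"

definition eps :: "('o, 'a) cat \<Rightarrow> 'o set \<Rightarrow> 'o \<Rightarrow> 'a" where
  "eps C U A = (THE h. h \<in> Hom C (U_hat C U A) A \<and>
     (\<forall>X\<in>U. \<forall>\<alpha>\<in>Hom C X A. h \<cdot>\<^bsub>C\<^esub> snd (U_hat_cop C U A) (X, \<alpha>) = \<alpha>))"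

text \<open>\<open>trace\<close> and \<open>trace2\<close> choose monomorphisms into \<open>A\<close> representing the subobjects
  \<open>tr(A)\<close> and \<open>tr\<^sup>2(A)\<close>.\<close>

definition trace :: "'k rel \<Rightarrow> ('o, 'a) cat \<Rightarrow> 'o set \<Rightarrow> 'o \<Rightarrow> 'a" where
  "trace \<kappa> C U A = (SOME m. is_subobject C m A \<and> Dom C m \<in> Gen \<kappa> C U \<and>
     (\<forall>n. is_subobject C n A \<and> Dom C n \<in> Gen \<kappa> C U \<longrightarrow> sub_le C n m))"

definition trace2 :: "'k rel \<Rightarrow> ('o, 'a) cat \<Rightarrow> 'o set \<Rightarrow> 'o \<Rightarrow> 'a" where
  "trace2 \<kappa> C U A = (SOME t. is_subobject C t A \<and> sub_le C (trace \<kappa> C U A) t \<and>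
     sub_eq C (quot_sub C (trace \<kappa> C U A) t) (trace \<kappa> C U (quot C (trace \<kappa> C U A))))"

text \<open>The subobjects \<open>tr(Ker \<epsilon>\<^sub>A)\<close> and \<open>tr\<^sup>2(Ker \<epsilon>\<^sub>A)\<close> of \<open>Ker \<epsilon>\<^sub>A\<close>, regarded as subobjects of
  the coproduct \<open>U_hat C U A\<close>.\<close>

definition tr_Ker_eps :: "'k rel \<Rightarrow> ('o, 'a) cat \<Rightarrow> 'o set \<Rightarrow> 'o \<Rightarrow> 'a" where
  "tr_Ker_eps \<kappa> C U A =
    ker C (eps C U A) \<cdot>\<^bsub>C\<^esub> trace \<kappa> C U (Dom C (ker C (eps C U A)))"

definition tr2_Ker_eps :: "'k rel \<Rightarrow> ('o, 'a) cat \<Rightarrow> 'o set \<Rightarrow> 'o \<Rightarrow> 'a" where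
  "tr2_Ker_eps \<kappa> C U A =
    ker C (eps C U A) \<cdot>\<^bsub>C\<^esub> trace2 \<kappa> C U (Dom C (ker C (eps C U A)))"

end

theory Submission
  imports Defs
begin

text \<open>
  Write \<open>K = Ker \<epsilon>\<^sub>A\<close>, \<open>W\<close> and \<open>V\<close> for the quotients of the canonical coproduct by \<open>tr(K)\<close> and
  \<open>tr\<^sup>2(K)\<close>, with induced arrows \<open>a : W \<rightarrow> A\<close>, \<open>r : W \<rightarrow> V\<close> and \<open>b : V \<rightarrow> A\<close>, so \<open>b \<cdot> r = a\<close>. Every arrow
  from a presented object to \<open>A\<close> lifts along \<open>a\<close>, because relations between the generators land
  in \<open>tr(K)\<close>; two lifts differ by an arrow into \<open>K/tr(K)\<close>, which \<open>r\<close> annihilates.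
  Hence \<open>b\<close> is a coreflection as soon as \<open>V\<close> is presented and nothing in \<open>U\<close> maps to
  \<open>K/tr\<^sup>2(K)\<close>, which is (4). If presented objects are closed under cokernels, then \<open>V\<close> is
  presented, \<open>b\<close> lifts to \<open>s : V \<rightarrow> W\<close>, and \<open>r \<cdot> s = 1\<close>, so \<open>Ker r = tr\<^sup>2(K)/tr(K)\<close> splits off.
  Conversely such a splitting makes \<open>V\<close> a direct summand of the presented object \<open>W\<close> and carries
  arrows into \<open>K/tr\<^sup>2(K)\<close> to arrows into \<open>K/tr(K)\<close>, which gives (4).
\<close>

section \<open>Preadditive and abelian categories\<close>

text \<open>Two quotients occur because existence and uniqueness of lifts pull in opposite
  directions. \<open>W\<close> is presented because \<open>tr(K)\<close> is covered by a coproduct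
  from \<open>U\<close>, but the kernel of \<open>a\<close> is \<open>K/tr(K)\<close>, which may
  still receive nonzero arrows from \<open>U\<close>. Dividing out the trace of that kernel gives
  \<open>V\<close>, and this can go wrong twice: \<open>tr\<^sup>2(K)\<close> is an extension of one
  generated object by another and need not be generated, so \<open>V\<close> need not be presented;
  and new arrows from \<open>U\<close> into \<open>K/tr\<^sup>2(K)\<close> may appear. For instance,
  with \<open>U\<close> consisting of the group of prime order p, the cyclic group of order p^2
  equals its own second trace without being generated. Conditions (2) and (3) are two ways to
  exclude both failures. All comparisons of quotients come from one statement,
  \<open>kernel_on_quotient\<close>. It is used four times: to construct \<open>tr\<^sup>2\<close>
  and to compute the kernels of \<open>r\<close>, \<open>a\<close> and \<open>b\<close>. Adjunctions
  are treated through pointwise universal arrows, so the formula for the adjoint on objects can be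
  read off directly.\<close>

context category
begin

lemma HomD:
  assumes "f \<in> Hom C A B"
  shows "f \<in> Arr C" "Dom C f = A" "Cod C f = B" "A \<in> Obj C" "B \<in> Obj C"
  using assms Dom_Obj Cod_Obj by (auto simp: Hom_def)

lemma Arr_Hom: "f \<in> Arr C \<Longrightarrow> f \<in> Hom C (Dom C f) (Cod C f)"
  by (simp add: Hom_def)

lemma monoD:
  "is_mono C m \<Longrightarrow> m \<in> Hom C A B \<Longrightarrow> g \<in> Hom C X A \<Longrightarrow> h \<in> Hom C X A \<Longrightarrow> m \<cdot> g = m \<cdot> h \<Longrightarrow> g = h"
  unfolding is_mono_def by (auto dest: HomD)

lemma monoI:
  assumes "m \<in> Hom C A B"
    and "\<And>X g h. g \<in> Hom C X A \<Longrightarrow> h \<in> Hom C X A \<Longrightarrow> m \<cdot> g = m \<cdot> h \<Longrightarrow> g = h"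
  shows "is_mono C m"
  unfolding is_mono_def using assms by (auto dest: HomD)

lemma epiD:
  "is_epi C e \<Longrightarrow> e \<in> Hom C A B \<Longrightarrow> g \<in> Hom C B X \<Longrightarrow> h \<in> Hom C B X \<Longrightarrow> g \<cdot> e = h \<cdot> e \<Longrightarrow> g = h"
  unfolding is_epi_def by (auto dest: HomD)

lemma epiI:
  assumes "e \<in> Hom C A B"
    and "\<And>X g h. g \<in> Hom C B X \<Longrightarrow> h \<in> Hom C B X \<Longrightarrow> g \<cdot> e = h \<cdot> e \<Longrightarrow> g = h"
  shows "is_epi C e"
  unfolding is_epi_def using assms by (auto dest: HomD)

lemma mono_comp:
  assumes "is_mono C m" "is_mono C n" and m: "m \<in> Hom C A B" and n: "n \<in> Hom C B D"
  shows "is_mono C (n \<cdot> m)"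
proof (rule monoI[OF Comp_Hom[OF m n]])
  fix X g h assume gh: "g \<in> Hom C X A" "h \<in> Hom C X A" "n \<cdot> m \<cdot> g = n \<cdot> m \<cdot> h"
  then have "n \<cdot> (m \<cdot> g) = n \<cdot> (m \<cdot> h)"
    using Comp_assoc m n by metis
  then show "g = h"
    using monoD[OF assms(2) n] monoD[OF assms(1) m] Comp_Hom m gh by metis
qed

lemma epi_comp:
  assumes "is_epi C e" "is_epi C d" and e: "e \<in> Hom C A B" and d: "d \<in> Hom C B D"
  shows "is_epi C (d \<cdot> e)"
proof (rule epiI[OF Comp_Hom[OF e d]])
  fix X g h assume gh: "g \<in> Hom C D X" "h \<in> Hom C D X" "g \<cdot> (d \<cdot> e) = h \<cdot> (d \<cdot> e)"
  then have "(g \<cdot> d) \<cdot> e = (h \<cdot> d) \<cdot> e"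
    using Comp_assoc e d by metis
  then show "g = h"
    using epiD[OF assms(2) d] epiD[OF assms(1) e] Comp_Hom d gh by metis
qed

lemma epi_cancel:
  assumes "is_epi C (d \<cdot> e)" and e: "e \<in> Hom C A B" and d: "d \<in> Hom C B D"
  shows "is_epi C d"
proof (rule epiI[OF d])
  fix X g h assume gh: "g \<in> Hom C D X" "h \<in> Hom C D X" "g \<cdot> d = h \<cdot> d"
  then have "g \<cdot> (d \<cdot> e) = h \<cdot> (d \<cdot> e)"
    using Comp_assoc[OF e d] by metis
  then show "g = h"
    using epiD[OF assms(1) Comp_Hom[OF e d]] gh by metis
qed

lemma split_epi:
  assumes r: "r \<in> Hom C A B" and s: "s \<in> Hom C B A" and "r \<cdot> s = Id C B"
  shows "is_epi C r"
proof (rule epiI[OF r])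
  fix X g h assume gh: "g \<in> Hom C B X" "h \<in> Hom C B X" "g \<cdot> r = h \<cdot> r"
  then have "g \<cdot> (r \<cdot> s) = h \<cdot> (r \<cdot> s)"
    using Comp_assoc[OF s r] by metis
  then show "g = h"
    using assms(3) Id_right gh by metis
qed

lemma split_mono:
  assumes r: "r \<in> Hom C A B" and s: "s \<in> Hom C B A" and "r \<cdot> s = Id C B"
  shows "is_mono C s"
proof (rule monoI[OF s])
  fix X g h assume gh: "g \<in> Hom C X B" "h \<in> Hom C X B" "s \<cdot> g = s \<cdot> h"
  then have "(r \<cdot> s) \<cdot> g = (r \<cdot> s) \<cdot> h"
    using Comp_assoc[OF _ s r] by metis
  then show "g = h"
    using assms(3) Id_left gh by metis
qed

lemma isomorphismI:
  assumes "f \<in> Hom C A B" "g \<in> Hom C B A" "g \<cdot> f = Id C A" "f \<cdot> g = Id C B"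
  shows "is_isomorphism C f"
  unfolding is_isomorphism_def using assms HomD(1-3)[OF assms(1)] by auto

lemma isomorphismE:
  assumes "is_isomorphism C f" "f \<in> Hom C A B"
  obtains g where "g \<in> Hom C B A" "g \<cdot> f = Id C A" "f \<cdot> g = Id C B"
  using assms HomD(1-3)[OF assms(2)] unfolding is_isomorphism_def by auto

end

section \<open>Differences and zero arrows in preadditive categories\<close>

context preadditive_category
begin

abbreviation hom_group where
  "hom_group A B \<equiv> \<lparr>carrier = Hom C A B, mult = add, one = zero A B\<rparr>"

lemma zero_Hom: "A \<in> Obj C \<Longrightarrow> B \<in> Obj C \<Longrightarrow> zero A B \<in> Hom C A B"
  using Hom_group[of A B] comm_group.axioms(1) Group.comm_monoid.axioms(1) monoid.one_closed
  by fastforce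

lemma add_Hom:
  assumes "f \<in> Hom C A B" "g \<in> Hom C A B"
  shows "add f g \<in> Hom C A B"
proof -
  interpret G: comm_group "hom_group A B"
    using Hom_group HomD(4,5)[OF assms(1)] .
  show ?thesis using G.m_closed[of f g] assms by simp
qed

lemma add_zero_left:
  assumes "f \<in> Hom C A B"
  shows "add (zero A B) f = f"
proof -
  interpret G: comm_group "hom_group A B"
    using Hom_group HomD(4,5)[OF assms(1)] .
  show ?thesis using G.l_one[of f] assms by simp
qed

lemma add_commute:
  assumes "f \<in> Hom C A B" "g \<in> Hom C A B"
  shows "add f g = add g f"
proof -
  interpret G: comm_group "hom_group A B"
    using Hom_group HomD(4,5)[OF assms(1)] .
  show ?thesis using G.m_comm[of f g] assms by simp
qed

lemma add_right_cancel:
  assumes "f \<in> Hom C A B" "g \<in> Hom C A B" "h \<in> Hom C A B"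
  shows "add f h = add g h \<longleftrightarrow> f = g"
proof -
  interpret G: comm_group "hom_group A B"
    using Hom_group HomD(4,5)[OF assms(1)] .
  show ?thesis using G.right_cancel[of h f g] assms by auto
qed

lemma zero_comp:
  assumes f: "f \<in> Hom C A B" and D: "D \<in> Obj C"
  shows "zero B D \<cdot> f = zero A D"
proof -
  have z: "zero B D \<in> Hom C B D" using zero_Hom HomD[OF f] D by simp
  have "add (zero B D \<cdot> f) (zero B D \<cdot> f) = add (zero A D) (zero B D \<cdot> f)"
    using Comp_add_left[OF f z z] add_zero_left[OF z] add_zero_left[OF Comp_Hom[OF f z]] by simp
  then show ?thesis
    using add_right_cancel Comp_Hom[OF f z] zero_Hom HomD[OF f] D by blast
qed

lemma comp_zero:
  assumes f: "f \<in> Hom C A B" and D: "D \<in> Obj C"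
  shows "f \<cdot> zero D A = zero D B"
proof -
  have z: "zero D A \<in> Hom C D A" using zero_Hom HomD[OF f] D by simp
  have "add (f \<cdot> zero D A) (f \<cdot> zero D A) = add (zero D B) (f \<cdot> zero D A)"
    using Comp_add_right[OF z z f] add_zero_left[OF z] add_zero_left[OF Comp_Hom[OF z f]] by simp
  then show ?thesis
    using add_right_cancel Comp_Hom[OF z f] zero_Hom HomD[OF f] D by blast
qed

text \<open>Subtraction is encoded as the solution of an equation, with the hom-set read off from
  \<open>f\<close>, so that it takes no object arguments. The group inverse appears only in the
  proof that a solution exists.\<close>

definition diff :: "'a \<Rightarrow> 'a \<Rightarrow> 'a" where
  "diff f g = (THE d. d \<in> Hom C (Dom C f) (Cod C f) \<and> add d g = f)"

lemma diff_props:
  assumes f: "f \<in> Hom C A B" and g: "g \<in> Hom C A B"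
  shows diff_Hom: "diff f g \<in> Hom C A B" and add_diff: "add (diff f g) g = f"
proof -
  interpret G: comm_group "hom_group A B"
    using Hom_group HomD(4,5)[OF f] .
  let ?d = "add f (inv\<^bsub>hom_group A B\<^esub> g)"
  have d: "?d \<in> Hom C A B" "add ?d g = f"
    using G.inv_closed[of g] G.m_closed[of f "inv\<^bsub>hom_group A B\<^esub> g"]
      G.m_assoc[of f "inv\<^bsub>hom_group A B\<^esub> g" g] G.l_inv[of g] G.r_one[of f] f g by simp_all
  have "diff f g = ?d"
    unfolding diff_def using d add_right_cancel[OF _ d(1) g] HomD[OF f]
    by (intro the_equality) auto
  with d show "diff f g \<in> Hom C A B" "add (diff f g) g = f" by simp_all
qed

lemma diff_unique:
  assumes "f \<in> Hom C A B" "g \<in> Hom C A B" "d \<in> Hom C A B" "add d g = f"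
  shows "diff f g = d"
  using add_right_cancel[OF diff_Hom assms(3,2)] add_diff assms by metis

lemma diff_eq_zero_iff:
  assumes "f \<in> Hom C A B" "g \<in> Hom C A B"
  shows "diff f g = zero A B \<longleftrightarrow> f = g"
  using diff_unique[OF assms] add_diff[OF assms] add_zero_left[OF assms(2)]
    zero_Hom HomD[OF assms(1)] by metis

lemma comp_diff:
  assumes f: "f \<in> Hom C A B" and g: "g \<in> Hom C A B" and h: "h \<in> Hom C B D"
  shows "h \<cdot> diff f g = diff (h \<cdot> f) (h \<cdot> g)"
proof (rule diff_unique[symmetric])
  show "add (h \<cdot> diff f g) (h \<cdot> g) = h \<cdot> f"
    using Comp_add_right[OF diff_Hom[OF f g] g h] add_diff[OF f g] by simp
qed (use Comp_Hom diff_Hom f g h in blast)+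

lemma diff_comp:
  assumes h: "h \<in> Hom C A B" and f: "f \<in> Hom C B D" and g: "g \<in> Hom C B D"
  shows "diff f g \<cdot> h = diff (f \<cdot> h) (g \<cdot> h)"
proof (rule diff_unique[symmetric])
  show "add (diff f g \<cdot> h) (g \<cdot> h) = f \<cdot> h"
    using Comp_add_left[OF h diff_Hom[OF f g] g] add_diff[OF f g] by simp
qed (use Comp_Hom diff_Hom f g h in blast)+

lemma mono_zeroI:
  assumes m: "m \<in> Hom C A B"
    and "\<And>X g. g \<in> Hom C X A \<Longrightarrow> m \<cdot> g = zero X B \<Longrightarrow> g = zero X A"
  shows "is_mono C m"
proof (rule monoI[OF m])
  fix X g h assume gh: "g \<in> Hom C X A" "h \<in> Hom C X A" "m \<cdot> g = m \<cdot> h"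
  then have "m \<cdot> diff g h = zero X B"
    using comp_diff[OF gh(1,2) m] diff_eq_zero_iff Comp_Hom m by metis
  then show "g = h"
    using assms(2) diff_Hom diff_eq_zero_iff gh by metis
qed

lemma epi_zeroI:
  assumes e: "e \<in> Hom C A B"
    and "\<And>X g. g \<in> Hom C B X \<Longrightarrow> g \<cdot> e = zero A X \<Longrightarrow> g = zero B X"
  shows "is_epi C e"
proof (rule epiI[OF e])
  fix X g h assume gh: "g \<in> Hom C B X" "h \<in> Hom C B X" "g \<cdot> e = h \<cdot> e"
  then have "diff g h \<cdot> e = zero A X"
    using diff_comp[OF e gh(1,2)] diff_eq_zero_iff Comp_Hom e by metis
  then show "g = h"
    using assms(2) diff_Hom diff_eq_zero_iff gh by metis
qed

lemma mono_zeroD: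
  assumes "is_mono C m" "m \<in> Hom C A B" "g \<in> Hom C X A" "m \<cdot> g = zero X B"
  shows "g = zero X A"
  using monoD[OF assms(1-3)] comp_zero[OF assms(2)] zero_Hom HomD assms by metis

lemma epi_zeroD:
  assumes "is_epi C e" "e \<in> Hom C A B" "g \<in> Hom C B X" "g \<cdot> e = zero A X"
  shows "g = zero B X"
  using epiD[OF assms(1-3)] zero_comp[OF assms(2)] zero_Hom HomD assms by metis

end

section \<open>Kernels, cokernels and images in abelian categories\<close>

context abelian_category
begin

text \<open>An arrow into a zero object is unique, hence equal to the zero of its hom-group, and
  composing with a group zero gives a group zero. This connects the definition through zero objects
  with additive computation.\<close>

lemma is_zero_arrow_iff:
  assumes f: "f \<in> Hom C A B"
  shows "is_zero_arrow C f \<longleftrightarrow> f = zero A B"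
proof
  assume "is_zero_arrow C f"
  then obtain Z g h where Z: "is_zero_object C Z" and g: "g \<in> Hom C A Z" and h: "h \<in> Hom C Z B"
    and fhg: "f = h \<cdot> g"
    unfolding is_zero_arrow_def using HomD[OF f] by auto
  have "g = zero A Z"
    using Z g zero_Hom HomD[OF g] unfolding is_zero_object_def by metis
  then show "f = zero A B"
    using fhg comp_zero[OF h] HomD[OF f] by simp
next
  assume f0: "f = zero A B"
  obtain Z where Z: "is_zero_object C Z" using ex_zero_object by blast
  then have "Z \<in> Obj C" unfolding is_zero_object_def by simp
  then have "zero A Z \<in> Hom C A Z" "zero Z B \<in> Hom C Z B" "f = zero Z B \<cdot> zero A Z"
    using zero_Hom zero_comp f0 HomD[OF f] by metis+
  then show "is_zero_arrow C f"
    unfolding is_zero_arrow_def using Z HomD[OF f] by auto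
qed

text \<open>Uniqueness of factorizations is carried by \<open>is_mono C k\<close>, so that later
  proofs only have to produce a factorization.\<close>

lemma kernelI:
  assumes f: "f \<in> Hom C A B" and k: "k \<in> Hom C K A" and "is_mono C k" "f \<cdot> k = zero K B"
    and "\<And>X g. g \<in> Hom C X A \<Longrightarrow> f \<cdot> g = zero X B \<Longrightarrow> \<exists>h\<in>Hom C X K. k \<cdot> h = g"
  shows "is_kernel C f k"
  unfolding is_kernel_def
proof (intro conjI ballI impI)
  show "is_zero_arrow C (f \<cdot> k)"
    using is_zero_arrow_iff Comp_Hom f k assms(4) by metis
  fix g assume g: "g \<in> Arr C" and "Cod C g = Dom C f \<and> is_zero_arrow C (f \<cdot> g)"
  then have g': "g \<in> Hom C (Dom C g) A" and "f \<cdot> g = zero (Dom C g) B"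
    using is_zero_arrow_iff[OF Comp_Hom[OF _ f]] HomD[OF f] unfolding Hom_def by auto
  then have "\<exists>h\<in>Hom C (Dom C g) K. k \<cdot> h = g" using assms(5) by blast
  then show "\<exists>!h. h \<in> Hom C (Dom C g) (Dom C k) \<and> k \<cdot> h = g"
    using monoD[OF assms(3) k] HomD[OF k] by auto
qed (use HomD f k in simp_all)

lemma kernel_props:
  assumes "is_kernel C f k" and f: "f \<in> Hom C A B"
  shows kernel_Hom: "k \<in> Hom C (Dom C k) A"
    and kernel_zero: "f \<cdot> k = zero (Dom C k) B"
    and kernel_mono: "is_mono C k"
proof -
  show k: "k \<in> Hom C (Dom C k) A"
    using assms HomD[OF f] unfolding is_kernel_def Hom_def by auto
  show fk: "f \<cdot> k = zero (Dom C k) B"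
    using is_zero_arrow_iff[OF Comp_Hom[OF k f]] assms unfolding is_kernel_def by auto
  show "is_mono C k"
  proof (rule monoI[OF k])
    fix X g h assume gh: "g \<in> Hom C X (Dom C k)" "h \<in> Hom C X (Dom C k)" "k \<cdot> g = k \<cdot> h"
    have kg: "k \<cdot> g \<in> Hom C X A" using Comp_Hom gh k by blast
    have "f \<cdot> (k \<cdot> g) = zero X B"
      using Comp_assoc[OF gh(1) k f] fk zero_comp[OF gh(1)] HomD[OF f] by simp
    then have "is_zero_arrow C (f \<cdot> (k \<cdot> g))"
      using is_zero_arrow_iff[OF Comp_Hom[OF kg f]] by simp
    then have "\<exists>!h. h \<in> Hom C X (Dom C k) \<and> k \<cdot> h = k \<cdot> g"
      using assms(1) HomD[OF kg] HomD[OF f] unfolding is_kernel_def by metis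
    then show "g = h" using gh by metis
  qed
qed

lemma kernel_factor:
  assumes "is_kernel C f k" and f: "f \<in> Hom C A B" and k: "k \<in> Hom C K A"
    and g: "g \<in> Hom C X A" and "f \<cdot> g = zero X B"
  obtains h where "h \<in> Hom C X K" "k \<cdot> h = g"
proof -
  have "is_zero_arrow C (f \<cdot> g)"
    using is_zero_arrow_iff[OF Comp_Hom[OF g f]] assms(5) by simp
  then have "\<exists>!h. h \<in> Hom C X K \<and> k \<cdot> h = g"
    using assms(1) HomD[OF g] HomD[OF f] HomD[OF k] unfolding is_kernel_def by metis
  then show ?thesis using that by blast
qed

lemma cokernelI:
  assumes f: "f \<in> Hom C A B" and p: "p \<in> Hom C B P" and "is_epi C p" "p \<cdot> f = zero A P"
    and "\<And>X g. g \<in> Hom C B X \<Longrightarrow> g \<cdot> f = zero A X \<Longrightarrow> \<exists>h\<in>Hom C P X. h \<cdot> p = g"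
  shows "is_cokernel C f p"
  unfolding is_cokernel_def
proof (intro conjI ballI impI)
  show "is_zero_arrow C (p \<cdot> f)"
    using is_zero_arrow_iff Comp_Hom f p assms(4) by metis
  fix g assume g: "g \<in> Arr C" and "Dom C g = Cod C f \<and> is_zero_arrow C (g \<cdot> f)"
  then have g': "g \<in> Hom C B (Cod C g)" and "g \<cdot> f = zero A (Cod C g)"
    using is_zero_arrow_iff[OF Comp_Hom[OF f]] HomD[OF f] unfolding Hom_def by auto
  then have "\<exists>h\<in>Hom C P (Cod C g). h \<cdot> p = g" using assms(5) by blast
  then show "\<exists>!h. h \<in> Hom C (Cod C p) (Cod C g) \<and> h \<cdot> p = g"
    using epiD[OF assms(3) p] HomD[OF p] by auto
qed (use HomD f p in simp_all)

lemma cokernel_props: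
  assumes "is_cokernel C f p" and f: "f \<in> Hom C A B"
  shows cokernel_Hom: "p \<in> Hom C B (Cod C p)"
    and cokernel_zero: "p \<cdot> f = zero A (Cod C p)"
    and cokernel_epi: "is_epi C p"
proof -
  show p: "p \<in> Hom C B (Cod C p)"
    using assms HomD[OF f] unfolding is_cokernel_def Hom_def by auto
  show pf: "p \<cdot> f = zero A (Cod C p)"
    using is_zero_arrow_iff[OF Comp_Hom[OF f p]] assms unfolding is_cokernel_def by auto
  show "is_epi C p"
  proof (rule epiI[OF p])
    fix X g h assume gh: "g \<in> Hom C (Cod C p) X" "h \<in> Hom C (Cod C p) X" "g \<cdot> p = h \<cdot> p"
    have gp: "g \<cdot> p \<in> Hom C B X" using Comp_Hom gh p by blast
    have "(g \<cdot> p) \<cdot> f = zero A X"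
      using Comp_assoc[OF f p gh(1)] pf comp_zero[OF gh(1)] HomD[OF f] by simp
    then have "is_zero_arrow C ((g \<cdot> p) \<cdot> f)"
      using is_zero_arrow_iff[OF Comp_Hom[OF f gp]] by simp
    then have "\<exists>!h. h \<in> Hom C (Cod C p) X \<and> h \<cdot> p = g \<cdot> p"
      using assms(1) HomD[OF gp] HomD[OF f] unfolding is_cokernel_def by metis
    then show "g = h" using gh by metis
  qed
qed

lemma cokernel_factor:
  assumes "is_cokernel C f p" and f: "f \<in> Hom C A B" and p: "p \<in> Hom C B P"
    and g: "g \<in> Hom C B X" and "g \<cdot> f = zero A X"
  obtains h where "h \<in> Hom C P X" "h \<cdot> p = g"
proof -
  have "is_zero_arrow C (g \<cdot> f)"
    using is_zero_arrow_iff[OF Comp_Hom[OF f g]] assms(5) by simp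
  then have "\<exists>!h. h \<in> Hom C P X \<and> h \<cdot> p = g"
    using assms(1) HomD[OF g] HomD[OF f] HomD[OF p] unfolding is_cokernel_def by metis
  then show ?thesis using that by blast
qed

lemma is_kernel_ker: "f \<in> Arr C \<Longrightarrow> is_kernel C f (ker C f)"
  unfolding ker_def by (rule someI_ex) (rule ex_kernel)

lemma is_cokernel_coker: "f \<in> Arr C \<Longrightarrow> is_cokernel C f (coker C f)"
  unfolding coker_def by (rule someI_ex) (rule ex_cokernel)

text \<open>By normality \<open>m\<close> is the kernel of some \<open>f\<close>. Since
  \<open>f\<close> kills \<open>m\<close> it factors through \<open>p\<close>, so whatever
  \<open>p\<close> kills is killed by \<open>f\<close> and factors through \<open>m\<close>.\<close>

lemma mono_kernel_of_cokernel:
  assumes "is_mono C m" and m: "m \<in> Hom C A B" and p: "is_cokernel C m p"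
  shows "is_kernel C p m"
proof -
  note pH = cokernel_Hom[OF p m]
  obtain f where f: "is_kernel C f m" using mono_normal assms(1) by blast
  then have fH: "f \<in> Hom C B (Cod C f)"
    using HomD[OF m] unfolding is_kernel_def Hom_def by auto
  have "f \<cdot> m = zero A (Cod C f)"
    using kernel_zero[OF f fH] HomD[OF m] by simp
  then obtain f' where f': "f' \<in> Hom C (Cod C p) (Cod C f)" "f' \<cdot> p = f"
    using cokernel_factor[OF p m pH fH] by blast
  show ?thesis
  proof (rule kernelI[OF pH m assms(1) cokernel_zero[OF p m]])
    fix X g assume g: "g \<in> Hom C X B" "p \<cdot> g = zero X (Cod C p)"
    then have "f \<cdot> g = zero X (Cod C f)"
      using Comp_assoc[OF g(1) pH f'(1)] f' comp_zero HomD by metis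
    then show "\<exists>h\<in>Hom C X A. m \<cdot> h = g"
      using kernel_factor[OF f fH m g(1)] by blast
  qed
qed

text \<open>Dual to \<open>mono_kernel_of_cokernel\<close>: normality makes \<open>e\<close> the
  cokernel of some \<open>f\<close>, and \<open>f\<close> factors through \<open>k\<close>.\<close>

lemma epi_cokernel_of_kernel:
  assumes "is_epi C e" and e: "e \<in> Hom C A B" and k: "is_kernel C e k"
  shows "is_cokernel C k e"
proof -
  note kH = kernel_Hom[OF k e]
  obtain f where f: "is_cokernel C f e" using epi_normal assms(1) by blast
  then have fH: "f \<in> Hom C (Dom C f) A"
    using HomD[OF e] unfolding is_cokernel_def Hom_def by auto
  have "e \<cdot> f = zero (Dom C f) B"
    using cokernel_zero[OF f fH] HomD[OF e] by simp
  then obtain f' where f': "f' \<in> Hom C (Dom C f) (Dom C k)" "k \<cdot> f' = f"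
    using kernel_factor[OF k e kH fH] by blast
  show ?thesis
  proof (rule cokernelI[OF kH e assms(1) kernel_zero[OF k e]])
    fix X g assume g: "g \<in> Hom C A X" "g \<cdot> k = zero (Dom C k) X"
    then have "g \<cdot> f = zero (Dom C f) X"
      using Comp_assoc[OF f'(1) kH g(1)] f' zero_comp HomD by metis
    then show "\<exists>h\<in>Hom C B X. h \<cdot> e = g"
      using cokernel_factor[OF f fH e g(1)] by blast
  qed
qed

text \<open>The image is the kernel of the cokernel of \<open>f\<close>. That \<open>e\<close> is
  epi expresses minimality: if \<open>t\<close> kills \<open>e\<close>, then \<open>f\<close>
  already factors through the smaller subobject \<open>Ker t\<close>, which is shown to be
  everything.\<close>

lemma image_factorization:
  assumes f: "f \<in> Hom C A B"
  obtains I m e where "e \<in> Hom C A I" "m \<in> Hom C I B" "is_epi C e" "is_mono C m" "m \<cdot> e = f"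
proof -
  obtain p where p: "is_cokernel C f p" using ex_cokernel HomD(1)[OF f] by blast
  note pH = cokernel_Hom[OF p f]
  obtain m where m: "is_kernel C p m" using ex_kernel HomD(1)[OF pH] by blast
  define I where "I = Dom C m"
  have mH: "m \<in> Hom C I B" and pm: "p \<cdot> m = zero I (Cod C p)" and mono: "is_mono C m"
    using kernel_props[OF m pH] by (simp_all add: I_def)
  obtain e where e: "e \<in> Hom C A I" "m \<cdot> e = f"
    using kernel_factor[OF m pH mH f cokernel_zero[OF p f]] .
  have "is_epi C e"
  proof (rule epi_zeroI[OF e(1)])
    fix X t assume t: "t \<in> Hom C I X" and te: "t \<cdot> e = zero A X"
    obtain j where j: "is_kernel C t j" using ex_kernel HomD(1)[OF t] by blast
    note jH = kernel_Hom[OF j t]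
    obtain e' where e': "e' \<in> Hom C A (Dom C j)" "j \<cdot> e' = e"
      using kernel_factor[OF j t jH e(1) te] .
    have mj: "m \<cdot> j \<in> Hom C (Dom C j) B" using Comp_Hom[OF jH mH] .
    \<comment> \<open>Normality turns the smaller subobject \<open>m \<cdot> j\<close> into the
      kernel of some \<open>h\<close>. As \<open>h\<close> kills \<open>f\<close>, it factors
      through \<open>p\<close> and kills \<open>m\<close> as well, so \<open>m\<close> factors
      through \<open>m \<cdot> j\<close> and \<open>j\<close> acquires a right inverse.\<close>
    obtain h where h: "is_kernel C h (m \<cdot> j)"
      using mono_normal mono_comp[OF kernel_mono[OF j t] mono jH mH] by blast
    then have hH: "h \<in> Hom C B (Cod C h)"
      using HomD[OF mj] unfolding is_kernel_def Hom_def by auto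
    have "h \<cdot> f = (h \<cdot> (m \<cdot> j)) \<cdot> e'"
      using Comp_assoc[OF e'(1) mj hH] Comp_assoc[OF e'(1) jH mH] e e' by simp
    also have "\<dots> = zero A (Cod C h)"
      using kernel_zero[OF h hH] HomD[OF mj] zero_comp[OF e'(1)] HomD(5)[OF hH] by simp
    finally obtain h' where h': "h' \<in> Hom C (Cod C p) (Cod C h)" "h' \<cdot> p = h"
      using cokernel_factor[OF p f pH hH] by blast
    have "h \<cdot> m = zero I (Cod C h)"
      using Comp_assoc[OF mH pH h'(1)] h' pm comp_zero[OF h'(1)] HomD[OF mH] by simp
    then obtain s where s: "s \<in> Hom C I (Dom C j)" "(m \<cdot> j) \<cdot> s = m"
      using kernel_factor[OF h hH mj mH] by blast
    have "m \<cdot> (j \<cdot> s) = m \<cdot> Id C I"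
      using Comp_assoc[OF s(1) jH mH] s Id_right[OF mH] by simp
    then have js: "j \<cdot> s = Id C I"
      using monoD[OF mono mH Comp_Hom[OF s(1) jH]] Id_Hom HomD[OF mH] by blast
    have "t = t \<cdot> (j \<cdot> s)" using js Id_right[OF t] by simp
    also have "\<dots> = zero I X"
      using Comp_assoc[OF s(1) jH t] kernel_zero[OF j t] zero_comp[OF s(1)] HomD[OF t] by simp
    finally show "t = zero I X" .
  qed
  with e mH mono show ?thesis using that by blast
qed

text \<open>Serves to replace an arrow by the epi part of its image factorization without changing
  its kernel.\<close>

lemma comp_mono_kernel:
  assumes n: "is_mono C n" "n \<in> Hom C D B" and d: "d \<in> Hom C A D" and s: "is_kernel C (n \<cdot> d) s"
  shows "is_kernel C d s"
proof -
  have nd: "n \<cdot> d \<in> Hom C A B" using Comp_Hom[OF d n(2)] .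
  note sH = kernel_Hom[OF s nd]
  show ?thesis
  proof (rule kernelI[OF d sH kernel_mono[OF s nd]])
    show "d \<cdot> s = zero (Dom C s) D"
      using mono_zeroD[OF n Comp_Hom[OF sH d]] Comp_assoc[OF sH d n(2)] kernel_zero[OF s nd] by simp
    fix X g assume g: "g \<in> Hom C X A" "d \<cdot> g = zero X D"
    then have "(n \<cdot> d) \<cdot> g = zero X B"
      using Comp_assoc[OF g(1) d n(2)] comp_zero[OF n(2)] HomD[OF g(1)] by simp
    then show "\<exists>h\<in>Hom C X (Dom C s). s \<cdot> h = g"
      using kernel_factor[OF s nd sH g(1)] by blast
  qed
qed

text \<open>Serves to replace a generated subobject by a coproduct covering it: the quotient stays
  the same, and the relations now come from \<open>Sum\<close>.\<close>

lemma comp_epi_cokernel: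
  assumes e: "is_epi C e" "e \<in> Hom C Y A" and t: "t \<in> Hom C A B" and p: "is_cokernel C t p"
  shows "is_cokernel C (t \<cdot> e) p"
proof -
  have te: "t \<cdot> e \<in> Hom C Y B" using Comp_Hom[OF e(2) t] .
  note pH = cokernel_Hom[OF p t]
  show ?thesis
  proof (rule cokernelI[OF te pH cokernel_epi[OF p t]])
    show "p \<cdot> (t \<cdot> e) = zero Y (Cod C p)"
      using Comp_assoc[OF e(2) t pH] cokernel_zero[OF p t] zero_comp[OF e(2)] HomD[OF pH] by simp
    fix X g assume g: "g \<in> Hom C B X" "g \<cdot> (t \<cdot> e) = zero Y X"
    then have "(g \<cdot> t) \<cdot> e = zero Y X"
      using Comp_assoc[OF e(2) t g(1)] by simp
    then have "g \<cdot> t = zero A X"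
      using epi_zeroD[OF e Comp_Hom[OF t g(1)]] by simp
    then show "\<exists>h\<in>Hom C (Cod C p) X. h \<cdot> p = g"
      using cokernel_factor[OF p t pH g(1)] by blast
  qed
qed

text \<open>This is \<open>Ker (A/T \<rightarrow> B) = (Ker f)/T\<close>. Pullbacks of epimorphisms are avoided: \<open>Ker g\<close> is
  compared with the image of \<open>p \<cdot> s\<close> through the cokernel of that image.\<close>

lemma kernel_on_quotient:
  assumes t: "is_mono C t" "t \<in> Hom C T A" and p: "is_cokernel C t p" and pH: "p \<in> Hom C A P"
    and s: "is_kernel C f s" and f: "f \<in> Hom C A B" and sH: "s \<in> Hom C S A"
    and g: "g \<in> Hom C P B" "g \<cdot> p = f"
    and i: "i \<in> Hom C T S" "s \<cdot> i = t"
    and \<pi>: "is_cokernel C i \<pi>" and \<pi>H: "\<pi> \<in> Hom C S Q"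
    and h: "h \<in> Hom C Q P" "h \<cdot> \<pi> = p \<cdot> s"
  shows "is_kernel C g h"
proof -
  note sm = kernel_mono[OF s f]
  note p_epi = cokernel_epi[OF p t(2)]
  note pi_epi = cokernel_epi[OF \<pi> i(1)]
  have fs: "f \<cdot> s = zero S B" using kernel_zero[OF s f] HomD[OF sH] by simp
  have pt: "p \<cdot> t = zero T P" using cokernel_zero[OF p t(2)] HomD[OF pH] by simp
  have ps: "p \<cdot> s \<in> Hom C S P" using Comp_Hom[OF sH pH] .
  obtain J m e where e: "e \<in> Hom C S J" and m: "m \<in> Hom C J P" and epi: "is_epi C e"
    and mono: "is_mono C m" and me: "m \<cdot> e = p \<cdot> s"
    using image_factorization[OF ps] .
  have ei: "e \<cdot> i = zero T J"
  proof (rule mono_zeroD[OF mono m Comp_Hom[OF i(1) e]])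
    show "m \<cdot> (e \<cdot> i) = zero T P"
      using Comp_assoc[OF i(1) e m] me Comp_assoc[OF i(1) sH pH] i pt by simp
  qed
  have "is_mono C i"
  proof (rule monoI[OF i(1)])
    fix X x y assume xy: "x \<in> Hom C X T" "y \<in> Hom C X T" "i \<cdot> x = i \<cdot> y"
    then have "t \<cdot> x = t \<cdot> y" using Comp_assoc[OF _ i(1) sH] i(2) by metis
    then show "x = y" using monoD[OF t xy(1,2)] by simp
  qed
  \<comment> \<open>What \<open>e\<close> kills is sent by \<open>s\<close> into the kernel of
    \<open>p\<close>, that is, into \<open>T\<close>. Hence \<open>i\<close> is the kernel of the
    epi \<open>e\<close>, so \<open>e\<close> and \<open>\<pi>\<close> are both cokernels of
    \<open>i\<close>, which identifies the image \<open>J\<close> with \<open>Q\<close>.\<close>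
  then have "is_kernel C e i"
  proof (rule kernelI[OF e i(1) _ ei])
    fix X x assume x: "x \<in> Hom C X S" "e \<cdot> x = zero X J"
    have "p \<cdot> (s \<cdot> x) = m \<cdot> (e \<cdot> x)"
      using Comp_assoc[OF x(1) sH pH] Comp_assoc[OF x(1) e m] me by simp
    then have "p \<cdot> (s \<cdot> x) = zero X P"
      using x comp_zero[OF m] HomD[OF x(1)] by simp
    then obtain y where y: "y \<in> Hom C X T" "t \<cdot> y = s \<cdot> x"
      using kernel_factor[OF mono_kernel_of_cokernel[OF t p] pH t(2) Comp_Hom[OF x(1) sH]] by blast
    then have "s \<cdot> (i \<cdot> y) = s \<cdot> x" using Comp_assoc[OF y(1) i(1) sH] i(2) by simp
    then have "i \<cdot> y = x" using monoD[OF sm sH Comp_Hom[OF y(1) i(1)] x(1)] by simp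
    then show "\<exists>y\<in>Hom C X T. i \<cdot> y = x" using y by blast
  qed
  then have e_coker: "is_cokernel C i e"
    using epi_cokernel_of_kernel[OF epi e] by simp
  obtain v where v: "v \<in> Hom C J Q" "v \<cdot> e = \<pi>"
    using cokernel_factor[OF e_coker i(1) e \<pi>H] cokernel_zero[OF \<pi> i(1)] HomD[OF \<pi>H] by metis
  obtain w where w: "w \<in> Hom C Q J" "w \<cdot> \<pi> = e"
    using cokernel_factor[OF \<pi> i(1) \<pi>H e ei] .
  have hv: "h \<cdot> v = m"
    using epiD[OF epi e Comp_Hom[OF v(1) h(1)] m] Comp_assoc[OF e v(1) h(1)] v h me by simp
  have vw: "v \<cdot> w = Id C Q"
    using epiD[OF pi_epi \<pi>H Comp_Hom[OF w(1) v(1)] Id_Hom] Comp_assoc[OF \<pi>H w(1) v(1)] v w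
      Id_left[OF \<pi>H] HomD[OF \<pi>H] by simp
  have "is_mono C h"
  proof (rule mono_zeroI[OF h(1)])
    fix X x assume x: "x \<in> Hom C X Q" "h \<cdot> x = zero X P"
    have x': "v \<cdot> (w \<cdot> x) = x"
      using Comp_assoc[OF x(1) w(1) v(1)] vw Id_left[OF x(1)] by simp
    have wx: "w \<cdot> x \<in> Hom C X J" using Comp_Hom[OF x(1) w(1)] .
    have "m \<cdot> (w \<cdot> x) = zero X P"
      using Comp_assoc[OF wx v(1) h(1)] hv x' x by simp
    then have "w \<cdot> x = zero X J" using mono_zeroD[OF mono m wx] by simp
    then show "x = zero X Q" using x' comp_zero[OF v(1)] HomD[OF x(1)] by simp
  qed
  moreover have "g \<cdot> h = zero Q B"
  proof (rule epi_zeroD[OF pi_epi \<pi>H Comp_Hom[OF h(1) g(1)]])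
    show "(g \<cdot> h) \<cdot> \<pi> = zero S B"
      using Comp_assoc[OF \<pi>H h(1) g(1)] h Comp_assoc[OF sH pH g(1)] g fs by simp
  qed
  moreover have "\<exists>x\<in>Hom C X Q. h \<cdot> x = y" if y: "y \<in> Hom C X P" "g \<cdot> y = zero X B" for X y
  proof -
    \<comment> \<open>Instead of lifting \<open>y\<close> along \<open>p\<close>, it is shown that
      the cokernel \<open>c\<close> of the image \<open>J\<close> kills \<open>y\<close>. The epi
      part \<open>d\<close> of \<open>f\<close> is a cokernel of \<open>s\<close>, and
      \<open>c \<cdot> p\<close> kills \<open>s\<close>, so \<open>c\<close> factors through
      \<open>d'\<close>; and \<open>d'\<close> kills \<open>y\<close> because \<open>g\<close>
      does.\<close>
    obtain D n d where d: "d \<in> Hom C A D" and n: "n \<in> Hom C D B" and d_epi: "is_epi C d"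
      and n_mono: "is_mono C n" and nd: "n \<cdot> d = f"
      using image_factorization[OF f] .
    have ds: "is_kernel C d s" using comp_mono_kernel[OF n_mono n d] s nd by simp
    note d_coker = epi_cokernel_of_kernel[OF d_epi d ds]
    have "d \<cdot> t = (d \<cdot> s) \<cdot> i" using Comp_assoc[OF i(1) sH d] i(2) by simp
    also have "\<dots> = zero T D"
      using kernel_zero[OF ds d] HomD[OF sH] HomD[OF d] zero_comp[OF i(1)] by simp
    finally obtain d' where d': "d' \<in> Hom C P D" "d' \<cdot> p = d"
      using cokernel_factor[OF p t(2) pH d] by blast
    have "n \<cdot> d' = g"
      using epiD[OF p_epi pH Comp_Hom[OF d'(1) n] g(1)] Comp_assoc[OF pH d'(1) n] d' nd g by simp
    then have "n \<cdot> (d' \<cdot> y) = zero X B" using Comp_assoc[OF y(1) d'(1) n] y by simp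
    then have dy: "d' \<cdot> y = zero X D" using mono_zeroD[OF n_mono n Comp_Hom[OF y(1) d'(1)]] by simp
    obtain c where c: "is_cokernel C m c" using ex_cokernel HomD[OF m] by blast
    note cH = cokernel_Hom[OF c m]
    have cp: "c \<cdot> p \<in> Hom C A (Cod C c)" using Comp_Hom[OF pH cH] .
    have "(c \<cdot> p) \<cdot> s = (c \<cdot> m) \<cdot> e"
      using Comp_assoc[OF sH pH cH] Comp_assoc[OF e m cH] me by simp
    also have "\<dots> = zero S (Cod C c)"
      using cokernel_zero[OF c m] zero_comp[OF e] HomD[OF cH] by simp
    finally obtain c' where c': "c' \<in> Hom C D (Cod C c)" "c' \<cdot> d = c \<cdot> p"
      using cokernel_factor[OF d_coker sH d cp] by blast
    have "c = c' \<cdot> d'"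
      using epiD[OF p_epi pH cH Comp_Hom[OF d'(1) c'(1)]] Comp_assoc[OF pH d'(1) c'(1)] c' d'
      by simp
    then have "c \<cdot> y = zero X (Cod C c)"
      using Comp_assoc[OF y(1) d'(1) c'(1)] dy comp_zero[OF c'(1)] HomD[OF y(1)] by simp
    then obtain y' where y': "y' \<in> Hom C X J" "m \<cdot> y' = y"
      using kernel_factor[OF mono_kernel_of_cokernel[OF mono m c] cH m y(1)] by blast
    then have "h \<cdot> (v \<cdot> y') = y" using Comp_assoc[OF y'(1) v(1) h(1)] hv by simp
    then show ?thesis using Comp_Hom[OF y'(1) v(1)] by blast
  qed
  ultimately show ?thesis by (rule kernelI[OF g(1) h(1)])
qed

end

section \<open>Coproducts and direct summands\<close>

context category
begin

lemma coproductI: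
  assumes "X \<in> Obj C" "\<And>i. i \<in> I \<Longrightarrow> c i \<in> Hom C (D i) X"
    and "\<And>Y d. Y \<in> Obj C \<Longrightarrow> (\<And>i. i \<in> I \<Longrightarrow> d i \<in> Hom C (D i) Y) \<Longrightarrow>
      \<exists>h\<in>Hom C X Y. \<forall>i\<in>I. h \<cdot> c i = d i"
    and "\<And>Y h h'. h \<in> Hom C X Y \<Longrightarrow> h' \<in> Hom C X Y \<Longrightarrow> (\<And>i. i \<in> I \<Longrightarrow> h \<cdot> c i = h' \<cdot> c i) \<Longrightarrow> h = h'"
  shows "is_coproduct C I D X c"
  unfolding is_coproduct_def
proof (intro conjI ballI allI impI)
  fix Y d assume Y: "Y \<in> Obj C" and d: "\<forall>i\<in>I. d i \<in> Hom C (D i) Y"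
  then obtain h where h: "h \<in> Hom C X Y" "\<forall>i\<in>I. h \<cdot> c i = d i"
    using assms(3)[of Y d] by blast
  show "\<exists>!h. h \<in> Hom C X Y \<and> (\<forall>i\<in>I. h \<cdot> c i = d i)"
  proof (rule ex1I[of _ h])
    fix x assume "x \<in> Hom C X Y \<and> (\<forall>i\<in>I. x \<cdot> c i = d i)"
    then show "x = h" by (intro assms(4)[OF _ h(1)]) (simp_all add: h(2))
  qed (use h in blast)
qed (use assms(1,2) in auto)

lemma coproduct_inj:
  assumes "is_coproduct C I D X c" "i \<in> I"
  shows "c i \<in> Hom C (D i) X"
  using assms unfolding is_coproduct_def by blast

lemma coproduct_factor:
  assumes "is_coproduct C I D X c" "Y \<in> Obj C" "\<And>i. i \<in> I \<Longrightarrow> d i \<in> Hom C (D i) Y"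
  obtains h where "h \<in> Hom C X Y" "\<And>i. i \<in> I \<Longrightarrow> h \<cdot> c i = d i"
proof -
  have "\<exists>!h. h \<in> Hom C X Y \<and> (\<forall>i\<in>I. h \<cdot> c i = d i)"
    using assms unfolding is_coproduct_def by blast
  then show ?thesis using that by blast
qed

lemma coproduct_unique:
  assumes "is_coproduct C I D X c" and h: "h \<in> Hom C X Y" "h' \<in> Hom C X Y"
    and eq: "\<And>i. i \<in> I \<Longrightarrow> h \<cdot> c i = h' \<cdot> c i"
  shows "h = h'"
proof -
  have "\<forall>i\<in>I. h \<cdot> c i \<in> Hom C (D i) Y"
    using coproduct_inj[OF assms(1)] Comp_Hom h(1) by blast
  then have "\<exists>!g. g \<in> Hom C X Y \<and> (\<forall>i\<in>I. g \<cdot> c i = h \<cdot> c i)"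
    by (intro assms(1)[unfolded is_coproduct_def, THEN conjunct2, THEN conjunct2, rule_format]
        HomD(5)[OF h(1)]) auto
  from the1_equality[OF this, of h] the1_equality[OF this, of h'] show ?thesis
    using h eq by force
qed

end

context abelian_category
begin

text \<open>The arrow \<open>1 - s \<cdot> r\<close> is killed by \<open>r\<close>, hence equals
  \<open>H \<cdot> w\<close> for some \<open>w\<close>. From
  \<open>H \<cdot> w + s \<cdot> r = 1\<close> follow \<open>w \<cdot> H = 1\<close> and
  \<open>w \<cdot> s = 0\<close>, so \<open>H\<close> and \<open>s\<close> are the injections of a
  biproduct.\<close>

lemma summandI:
  assumes H: "is_kernel C r H" "H \<in> Hom C S W" and r: "r \<in> Hom C W V"
    and s: "s \<in> Hom C V W" and rs: "r \<cdot> s = Id C V"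
  shows "is_direct_summand C H"
proof -
  have sr: "s \<cdot> r \<in> Hom C W W" using Comp_Hom[OF r s] .
  have IdW: "Id C W \<in> Hom C W W" using Id_Hom HomD[OF r] by blast
  have rH: "r \<cdot> H = zero S V" using kernel_zero[OF H(1) r] HomD[OF H(2)] by simp
  note mono = kernel_mono[OF H(1) r]
  have "r \<cdot> diff (Id C W) (s \<cdot> r) = zero W V"
    using comp_diff[OF IdW sr r] Id_right[OF r] Comp_assoc[OF r s r] rs Id_left[OF r]
      diff_eq_zero_iff[OF r r] by simp
  then obtain w where w: "w \<in> Hom C W S" "H \<cdot> w = diff (Id C W) (s \<cdot> r)"
    using kernel_factor[OF H(1) r H(2) diff_Hom[OF IdW sr]] by blast
  have Hw: "H \<cdot> w \<in> Hom C W W" using Comp_Hom[OF w(1) H(2)] .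
  have sum: "add (H \<cdot> w) (s \<cdot> r) = Id C W" using w add_diff[OF IdW sr] by simp
  have wH: "w \<cdot> H = Id C S"
  proof (rule monoD[OF mono H(2) Comp_Hom[OF H(2) w(1)] Id_Hom])
    have "H \<cdot> (w \<cdot> H) = add (H \<cdot> w \<cdot> H) (s \<cdot> r \<cdot> H)"
      using Comp_assoc[OF H(2) w(1) H(2)] Comp_assoc[OF H(2) r s] rH comp_zero[OF s]
        add_commute add_zero_left Comp_Hom[OF H(2) Hw] zero_Hom HomD[OF H(2)] by metis
    also have "\<dots> = Id C W \<cdot> H"
      using Comp_add_left[OF H(2) Hw sr] sum by simp
    finally show "H \<cdot> (w \<cdot> H) = H \<cdot> Id C S"
      using Id_left[OF H(2)] Id_right[OF H(2)] by simp
  qed (use HomD[OF H(2)] in simp)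
  have ws: "w \<cdot> s = zero V S"
  proof (rule mono_zeroD[OF mono H(2) Comp_Hom[OF s w(1)]])
    have "H \<cdot> (w \<cdot> s) = diff (Id C W \<cdot> s) (s \<cdot> r \<cdot> s)"
      using Comp_assoc[OF s w(1) H(2)] w(2) diff_comp[OF s IdW sr] by simp
    then show "H \<cdot> (w \<cdot> s) = zero V W"
      using Comp_assoc[OF s r s] rs Id_left[OF s] Id_right[OF s] diff_eq_zero_iff[OF s s] by simp
  qed
  have dom: "Dom C (if b then H else s) = (if b then S else V)" for b
    using HomD[OF H(2)] HomD[OF s] by simp
  have "is_coproduct C UNIV (\<lambda>b. if b then S else V) W (\<lambda>b. if b then H else s)"
  proof (rule coproductI)
    fix Y d assume d: "\<And>b. b \<in> UNIV \<Longrightarrow> d b \<in> Hom C (if b then S else V) Y"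
    have d1: "d True \<in> Hom C S Y" and d2: "d False \<in> Hom C V Y"
      using d[of True] d[of False] by simp_all
    have dw: "d True \<cdot> w \<in> Hom C W Y" and dr: "d False \<cdot> r \<in> Hom C W Y"
      using Comp_Hom d1 d2 w(1) r by blast+
    define h where "h = add (d True \<cdot> w) (d False \<cdot> r)"
    have h: "h \<in> Hom C W Y" using add_Hom[OF dw dr] by (simp add: h_def)
    have "h \<cdot> H = add (d True) (zero S Y)"
      using Comp_add_left[OF H(2) dw dr] Comp_assoc[OF H(2) w(1) d1] Comp_assoc[OF H(2) r d2]
        wH rH comp_zero[OF d2] Id_right[OF d1] HomD[OF H(2)] by (simp add: h_def)
    then have hH: "h \<cdot> H = d True"
      using add_commute[OF d1 zero_Hom] add_zero_left[OF d1] HomD[OF d1] by simp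
    have "h \<cdot> s = add (zero V Y) (d False)"
      using Comp_add_left[OF s dw dr] Comp_assoc[OF s w(1) d1] Comp_assoc[OF s r d2]
        ws rs comp_zero[OF d1] Id_right[OF d2] HomD[OF s] by (simp add: h_def)
    then have hs: "h \<cdot> s = d False" using add_zero_left[OF d2] by simp
    show "\<exists>h\<in>Hom C W Y. \<forall>b\<in>UNIV. h \<cdot> (if b then H else s) = d b"
      using h hH hs by (intro bexI[of _ h]) auto
  next
    fix Y x y assume x: "x \<in> Hom C W Y" and y: "y \<in> Hom C W Y"
      and xy: "\<And>b. b \<in> UNIV \<Longrightarrow> x \<cdot> (if b then H else s) = y \<cdot> (if b then H else s)"
    have eq: "z = add (z \<cdot> H \<cdot> w) (z \<cdot> s \<cdot> r)" if z: "z \<in> Hom C W Y" for z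
    proof -
      have "z \<cdot> add (H \<cdot> w) (s \<cdot> r) = z" using sum Id_right[OF z] by simp
      then show ?thesis
        using Comp_add_right[OF Hw sr z] Comp_assoc[OF w(1) H(2) z] Comp_assoc[OF r s z] by simp
    qed
    have "x \<cdot> H = y \<cdot> H" "x \<cdot> s = y \<cdot> s" using xy[of True] xy[of False] by simp_all
    then show "x = y" using eq[OF x] eq[OF y] by simp
  qed (use HomD[OF H(2)] H(2) s in simp_all)
  then show ?thesis
    unfolding is_direct_summand_def using HomD[OF H(2)] HomD[OF s] dom by auto
qed

text \<open>The universal property is applied to the identity on the summand and zero on its
  complement.\<close>

lemma summand_retraction:
  assumes H: "is_direct_summand C H" "H \<in> Hom C S W"
  obtains w where "w \<in> Hom C W S" "w \<cdot> H = Id C S"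
proof -
  obtain j where j: "is_coproduct C UNIV (\<lambda>b. Dom C (if b then H else j)) W (\<lambda>b. if b then H else j)"
    using assms HomD[OF H(2)] unfolding is_direct_summand_def by auto
  have jH: "j \<in> Hom C (Dom C j) W" using j unfolding is_coproduct_def by (auto split: if_splits)
  let ?d = "\<lambda>b. if b then Id C S else zero (Dom C j) S"
  obtain w where w: "w \<in> Hom C W S" "\<And>b. w \<cdot> (if b then H else j) = ?d b"
  proof (rule coproduct_factor[OF j])
    show "S \<in> Obj C" using HomD[OF H(2)] by simp
    show "?d b \<in> Hom C (Dom C (if b then H else j)) S" for b
      using Id_Hom zero_Hom HomD[OF H(2)] HomD[OF jH] by auto
  qed auto
  then show ?thesis using that[OF w(1)] w(2)[of True] by simp
qed

text \<open>The arrow \<open>1 - H \<cdot> w\<close> kills \<open>H\<close> and so descends along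
  the cokernel \<open>r\<close>; the induced arrow is the section \<open>s\<close>.\<close>

lemma summand_complement:
  assumes r: "is_cokernel C H r" "r \<in> Hom C W V" and H: "H \<in> Hom C S W"
    and w: "w \<in> Hom C W S" "w \<cdot> H = Id C S"
  obtains s where "s \<in> Hom C V W" "r \<cdot> s = Id C V" "is_direct_summand C s"
proof -
  have Hw: "H \<cdot> w \<in> Hom C W W" using Comp_Hom[OF w(1) H] .
  have IdW: "Id C W \<in> Hom C W W" using Id_Hom HomD[OF H] by blast
  have rH: "r \<cdot> H = zero S V" using cokernel_zero[OF r(1) H] HomD[OF r(2)] by simp
  note epi = cokernel_epi[OF r(1) H]
  have "diff (Id C W) (H \<cdot> w) \<cdot> H = zero S W"
    using diff_comp[OF H IdW Hw] Comp_assoc[OF H w(1) H] w Id_left[OF H] Id_right[OF H]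
      diff_eq_zero_iff[OF H H] by simp
  then obtain s where s: "s \<in> Hom C V W" "s \<cdot> r = diff (Id C W) (H \<cdot> w)"
    using cokernel_factor[OF r(1) H r(2) diff_Hom[OF IdW Hw]] by blast
  have rs: "r \<cdot> s = Id C V"
  proof (rule epiD[OF epi r(2) Comp_Hom[OF s(1) r(2)] Id_Hom])
    have "r \<cdot> s \<cdot> r = diff (r \<cdot> Id C W) (r \<cdot> (H \<cdot> w))"
      using Comp_assoc[OF r(2) s(1) r(2)] s(2) comp_diff[OF IdW Hw r(2)] by simp
    also have "\<dots> = diff r (zero W V)"
      using Id_right[OF r(2)] Comp_assoc[OF w(1) H r(2)] rH zero_comp[OF w(1)] HomD[OF r(2)] by simp
    also have "\<dots> = r"
      using diff_unique[OF r(2) zero_Hom r(2)] add_commute[OF r(2) zero_Hom]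
        add_zero_left[OF r(2)] HomD[OF r(2)] by simp
    finally show "r \<cdot> s \<cdot> r = Id C V \<cdot> r" using Id_left[OF r(2)] by simp
  qed (use HomD[OF r(2)] in simp)
  have "is_kernel C w s"
  proof (rule kernelI[OF w(1) s(1) split_mono[OF r(2) s(1) rs]])
    show "w \<cdot> s = zero V S"
    proof (rule epi_zeroD[OF epi r(2) Comp_Hom[OF s(1) w(1)]])
      have "w \<cdot> s \<cdot> r = diff (w \<cdot> Id C W) (w \<cdot> (H \<cdot> w))"
        using Comp_assoc[OF r(2) s(1) w(1)] s(2) comp_diff[OF IdW Hw w(1)] by simp
      also have "\<dots> = diff w w"
        using Comp_assoc[OF w(1) H w(1)] w Id_left[OF w(1)] Id_right[OF w(1)] by simp
      finally show "w \<cdot> s \<cdot> r = zero W S" using diff_eq_zero_iff[OF w(1) w(1)] by simp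
    qed
    fix X x assume x: "x \<in> Hom C X W" "w \<cdot> x = zero X S"
    have "s \<cdot> (r \<cdot> x) = diff (Id C W \<cdot> x) (H \<cdot> w \<cdot> x)"
      using Comp_assoc[OF x(1) r(2) s(1)] s(2) diff_comp[OF x(1) IdW Hw] by simp
    also have "\<dots> = diff x (zero X W)"
      using Comp_assoc[OF x(1) w(1) H] x comp_zero[OF H] Id_left[OF x(1)] HomD[OF x(1)] by simp
    also have "\<dots> = x"
      using diff_unique[OF x(1) zero_Hom x(1)] add_commute[OF x(1) zero_Hom]
        add_zero_left[OF x(1)] HomD[OF x(1)] by simp
    finally show "\<exists>h\<in>Hom C X V. s \<cdot> h = x" using Comp_Hom[OF x(1) r(2)] by blast
  qed
  \<comment> \<open>The roles are exchanged: \<open>w\<close> is now the split epi, \<open>H\<close>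
    its section, and \<open>s\<close> its kernel.\<close>
  then have "is_direct_summand C s" using summandI[OF _ s(1) w(1) H w(2)] by simp
  with s rs show ?thesis using that by blast
qed

text \<open>A retraction \<open>w\<close> of \<open>i\<close> is the cokernel of the idempotent
  \<open>1 - i \<cdot> w\<close>, which is an endomorphism of an object of \<open>B\<close>.\<close>

lemma closed_under_cokernels_summands:
  assumes B: "closed_under_cokernels C B"
  shows "closed_under_summands C B"
  unfolding closed_under_summands_def
proof (intro allI impI)
  fix i assume i: "is_direct_summand C i \<and> Cod C i \<in> B"
  define X Y where "X = Dom C i" and "Y = Cod C i"
  have iH: "i \<in> Hom C X Y" using i Arr_Hom unfolding is_direct_summand_def X_def Y_def by blast
  obtain w where w: "w \<in> Hom C Y X" "w \<cdot> i = Id C X"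
    using summand_retraction i iH by blast
  have iw: "i \<cdot> w \<in> Hom C Y Y" using Comp_Hom[OF w(1) iH] .
  have IdY: "Id C Y \<in> Hom C Y Y" using Id_Hom HomD[OF iH] by blast
  note d = diff_Hom[OF IdY iw]
  have "is_cokernel C (diff (Id C Y) (i \<cdot> w)) w"
  proof (rule cokernelI[OF d w(1) split_epi[OF w(1) iH w(2)]])
    show "w \<cdot> diff (Id C Y) (i \<cdot> w) = zero Y X"
      using comp_diff[OF IdY iw w(1)] Comp_assoc[OF w(1) iH w(1)] w Id_left[OF w(1)]
        Id_right[OF w(1)] diff_eq_zero_iff[OF w(1) w(1)] by simp
    fix Z x assume x: "x \<in> Hom C Y Z" "x \<cdot> diff (Id C Y) (i \<cdot> w) = zero Y Z"
    then have "x \<cdot> Id C Y = x \<cdot> (i \<cdot> w)"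
      using comp_diff[OF IdY iw x(1)] diff_eq_zero_iff[OF Comp_Hom[OF IdY x(1)] Comp_Hom[OF iw x(1)]]
      by simp
    then have "(x \<cdot> i) \<cdot> w = x" using Comp_assoc[OF w(1) iH x(1)] Id_right[OF x(1)] by simp
    then show "\<exists>h\<in>Hom C X Z. h \<cdot> w = x" using Comp_Hom[OF iH x(1)] by blast
  qed
  then have "Cod C w \<in> B"
    using B i HomD[OF d] unfolding closed_under_cokernels_def Y_def by metis
  then show "Dom C i \<in> B" using HomD[OF w(1)] by (simp add: X_def)
qed

end

section \<open>Coreflections\<close>

context category
begin

text \<open>The universal arrow from \<open>B\<close> to a single object \<open>A\<close>, that is,
  one component of the counit. It allows objects to be treated one at a time, before any functor is
  built.\<close>

definition coreflection :: "'o set \<Rightarrow> 'o \<Rightarrow> 'o \<Rightarrow> 'a \<Rightarrow> bool" where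
  "coreflection B A V b \<longleftrightarrow> V \<in> B \<and> b \<in> Hom C V A \<and>
    (\<forall>Q\<in>B. \<forall>g\<in>Hom C Q A. \<exists>!g'. g' \<in> Hom C Q V \<and> b \<cdot> g' = g)"

lemma coreflection_factor:
  assumes "coreflection B A V b" "Q \<in> B" "g \<in> Hom C Q A"
  obtains g' where "g' \<in> Hom C Q V" "b \<cdot> g' = g"
  using assms unfolding coreflection_def by blast

lemma coreflection_unique:
  assumes "coreflection B A V b" "Q \<in> B" "x \<in> Hom C Q V" "y \<in> Hom C Q V" "b \<cdot> x = b \<cdot> y"
  shows "x = y"
  using assms Comp_Hom[of x Q V b A] unfolding coreflection_def by metis

lemma Hom_full_subcat: "X \<in> B \<Longrightarrow> Y \<in> B \<Longrightarrow> Hom (full_subcat C B) X Y = Hom C X Y"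
  unfolding full_subcat_def Hom_def by auto

lemma full_subcat_simps [simp]:
  "Obj (full_subcat C B) = B" "Dom (full_subcat C B) = Dom C" "Cod (full_subcat C B) = Cod C"
  "Id (full_subcat C B) = Id C" "Comp (full_subcat C B) = Comp C"
  "Arr (full_subcat C B) = {f \<in> Arr C. Dom C f \<in> B \<and> Cod C f \<in> B}"
  unfolding full_subcat_def by simp_all

lemma inclusion_simps [simp]: "OMap inclusion A = A" "AMap inclusion f = f"
  unfolding inclusion_def by simp_all

text \<open>The functor takes the given objects \<open>V A\<close> as its values, so a formula for
  them passes literally to the adjoint. Transposition and the action on arrows are unique lifts
  along \<open>b\<close>, and every functoriality or naturality equation is checked after composing
  with \<open>b\<close>.\<close>

lemma right_adjoint_of_coreflections:
  assumes B: "B \<subseteq> Obj C" and co: "\<And>A. A \<in> Obj C \<Longrightarrow> coreflection B A (V A) (b A)"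
  shows "\<exists>q. right_adjoint (full_subcat C B) C inclusion q \<and> (\<forall>A\<in>Obj C. OMap q A = V A)"
proof -
  define L where "L X A g = (THE g'. g' \<in> Hom C X (V A) \<and> b A \<cdot> g' = g)" for X A g
  have L: "L X A g \<in> Hom C X (V A)" "b A \<cdot> L X A g = g" if "X \<in> B" "g \<in> Hom C X A" for X A g
  proof -
    have "\<exists>!g'. g' \<in> Hom C X (V A) \<and> b A \<cdot> g' = g"
      using co[of A] that HomD(5)[OF that(2)] unfolding coreflection_def by blast
    from theI'[OF this] show "L X A g \<in> Hom C X (V A)" "b A \<cdot> L X A g = g"
      unfolding L_def by simp_all
  qed
  have VB: "V A \<in> B" and bH: "b A \<in> Hom C (V A) A" if "A \<in> Obj C" for A
    using co[OF that] unfolding coreflection_def by auto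
  have uniq: "x = y" if "A \<in> Obj C" "X \<in> B" "x \<in> Hom C X (V A)" "y \<in> Hom C X (V A)" "b A \<cdot> x = b A \<cdot> y"
    for A X x y using coreflection_unique[OF co[OF that(1)] that(2-5)] .
  define q where "q = \<lparr>OMap = V, AMap = (\<lambda>v. L (V (Dom C v)) (Cod C v) (v \<cdot> b (Dom C v)))\<rparr>"
  have qH: "AMap q v \<in> Hom C (V A) (V A')" and bq: "b A' \<cdot> AMap q v = v \<cdot> b A"
    if v: "v \<in> Hom C A A'" for A A' v
    using L[OF VB Comp_Hom[OF bH v]] HomD[OF v] by (simp_all add: q_def)
  have "is_functor (full_subcat C B) C inclusion"
    unfolding is_functor_def using B Arr_Hom by auto
  moreover have "is_functor C (full_subcat C B) q"
    unfolding is_functor_def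
  proof (intro conjI ballI impI)
    fix A assume A: "A \<in> Obj C"
    show "OMap q A \<in> Obj (full_subcat C B)" using VB[OF A] by (simp add: q_def)
    have "AMap q (Id C A) = Id C (V A)"
    proof (rule uniq[OF A VB[OF A] qH[OF Id_Hom[OF A]] Id_Hom])
      show "b A \<cdot> AMap q (Id C A) = b A \<cdot> Id C (V A)"
        using bq[OF Id_Hom[OF A]] Id_left[OF bH[OF A]] Id_right[OF bH[OF A]] by simp
    qed (use VB A B in blast)
    then show "AMap q (Id C A) = Id (full_subcat C B) (OMap q A)" by (simp add: q_def)
  next
    fix f assume f: "f \<in> Arr C"
    have "Hom (full_subcat C B) (V (Dom C f)) (V (Cod C f)) = Hom C (V (Dom C f)) (V (Cod C f))"
      using Hom_full_subcat VB Dom_Obj Cod_Obj f by simp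
    then show "AMap q f \<in> Hom (full_subcat C B) (OMap q (Dom C f)) (OMap q (Cod C f))"
      using qH[OF Arr_Hom[OF f]] by (simp add: q_def)
  next
    fix f g assume f: "f \<in> Arr C" and g: "g \<in> Arr C" and fg: "Cod C f = Dom C g"
    define A A' A'' where "A = Dom C f" and "A' = Cod C f" and "A'' = Cod C g"
    have f': "f \<in> Hom C A A'" and g': "g \<in> Hom C A' A''"
      using Arr_Hom[OF f] Arr_Hom[OF g] fg unfolding A_def A'_def A''_def by simp_all
    have "AMap q (g \<cdot> f) = AMap q g \<cdot> AMap q f"
    proof (rule uniq[OF _ VB qH[OF Comp_Hom[OF f' g']] Comp_Hom[OF qH[OF f'] qH[OF g']]])
      show "b A'' \<cdot> AMap q (g \<cdot> f) = b A'' \<cdot> (AMap q g \<cdot> AMap q f)"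
        using bq[OF Comp_Hom[OF f' g']] bq[OF f'] bq[OF g'] HomD[OF f'] HomD[OF g']
          Comp_assoc[OF qH[OF f'] qH[OF g'] bH[of A'']] Comp_assoc[OF qH[OF f'] bH[of A'] g']
          Comp_assoc[OF bH[of A] f' g'] by simp
    qed (use HomD[OF f'] HomD[OF g'] in auto)
    then show "AMap q (g \<cdot> f) = AMap q g \<cdot>\<^bsub>full_subcat C B\<^esub> AMap q f" by simp
  qed
  moreover have "bij_betw (L X Y) (Hom C (OMap inclusion X) Y) (Hom (full_subcat C B) X (OMap q Y))"
    if X: "X \<in> Obj (full_subcat C B)" and Y: "Y \<in> Obj C" for X Y
  proof (rule bij_betwI[of _ _ _ "\<lambda>g. b Y \<cdot> g"])
    have X': "X \<in> B" and hom: "Hom (full_subcat C B) X (OMap q Y) = Hom C X (V Y)"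
      using X Hom_full_subcat VB[OF Y] by (simp_all add: q_def)
    show "L X Y \<in> Hom C (OMap inclusion X) Y \<rightarrow> Hom (full_subcat C B) X (OMap q Y)"
      using L[OF X'] hom by simp
    show "(\<lambda>g. b Y \<cdot> g) \<in> Hom (full_subcat C B) X (OMap q Y) \<rightarrow> Hom C (OMap inclusion X) Y"
      using Comp_Hom[OF _ bH[OF Y]] hom by simp
    show "b Y \<cdot> L X Y f = f" if "f \<in> Hom C (OMap inclusion X) Y" for f
      using that L[OF X'] by simp
    show "L X Y (b Y \<cdot> g) = g" if "g \<in> Hom (full_subcat C B) X (OMap q Y)" for g
    proof -
      have g: "g \<in> Hom C X (V Y)" using that hom by simp
      then have bg: "b Y \<cdot> g \<in> Hom C X Y" using Comp_Hom[OF _ bH[OF Y]] by blast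
      show ?thesis using uniq[OF Y X' L(1)[OF X' bg] g L(2)[OF X' bg]] .
    qed
  qed
  moreover have "L (Dom C u) (Cod C v) (v \<cdot> f \<cdot> u) = AMap q v \<cdot> L (Cod C u) (Dom C v) f \<cdot> u"
    if u: "u \<in> Arr (full_subcat C B)" and v: "v \<in> Arr C" and f: "f \<in> Hom C (Cod C u) (Dom C v)" for u v f
  proof -
    have u': "u \<in> Hom C (Dom C u) (Cod C u)" "Dom C u \<in> B" "Cod C u \<in> B"
      using u Arr_Hom by auto
    note v' = Arr_Hom[OF v]
    have vfu: "v \<cdot> f \<cdot> u \<in> Hom C (Dom C u) (Cod C v)"
      using Comp_Hom[OF u'(1) Comp_Hom[OF f v']] .
    note Lf = L[OF u'(3) f]
    note qv = qH[OF v']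
    note bv = bH[OF HomD(5)[OF v']]
    show ?thesis
    proof (rule uniq[OF HomD(5)[OF v'] u'(2) L(1)[OF u'(2) vfu]
          Comp_Hom[OF u'(1) Comp_Hom[OF Lf(1) qv]]])
      have "b (Cod C v) \<cdot> (AMap q v \<cdot> L (Cod C u) (Dom C v) f \<cdot> u)
          = v \<cdot> b (Dom C v) \<cdot> L (Cod C u) (Dom C v) f \<cdot> u"
        using Comp_assoc[OF u'(1) Comp_Hom[OF Lf(1) qv] bv] Comp_assoc[OF Lf(1) qv bv] bq[OF v']
        by simp
      also have "\<dots> = v \<cdot> f \<cdot> u"
        using Comp_assoc[OF Lf(1) bH[OF HomD(4)[OF v']] v'] Lf(2) by simp
      finally show "b (Cod C v) \<cdot> L (Dom C u) (Cod C v) (v \<cdot> f \<cdot> u)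
          = b (Cod C v) \<cdot> (AMap q v \<cdot> L (Cod C u) (Dom C v) f \<cdot> u)"
        using L(2)[OF u'(2) vfu] by simp
    qed
  qed
  ultimately have "right_adjoint (full_subcat C B) C inclusion q"
    unfolding right_adjoint_def by (intro conjI exI[of _ L] ballI) simp_all
  then show ?thesis by (intro exI[of _ q]) (simp add: q_def)
qed

text \<open>The counit \<open>c A\<close> is the preimage of the identity under
  \<open>\<Phi>\<close>. Naturality gives \<open>\<Phi> (c A \<cdot> u) = u\<close>, so composition
  with \<open>c A\<close> inverts \<open>\<Phi>\<close>, and lifts along \<open>c A\<close> exist
  uniquely.\<close>

lemma coreflections_of_right_adjoint:
  assumes B: "B \<subseteq> Obj C" and q: "right_adjoint (full_subcat C B) C inclusion q"
  obtains c where "\<And>A. A \<in> Obj C \<Longrightarrow> coreflection B A (OMap q A) (c A)"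
    and "\<And>v A A'. v \<in> Hom C A A' \<Longrightarrow> AMap q v \<in> Hom C (OMap q A) (OMap q A') \<and> c A' \<cdot> AMap q v = v \<cdot> c A"
proof -
  obtain \<Phi> where q_functor: "is_functor C (full_subcat C B) q"
    and bij: "\<And>X Y. X \<in> B \<Longrightarrow> Y \<in> Obj C \<Longrightarrow>
      bij_betw (\<Phi> X Y) (Hom C X Y) (Hom (full_subcat C B) X (OMap q Y))"
    and nat: "\<And>u v f. u \<in> Arr (full_subcat C B) \<Longrightarrow> v \<in> Arr C \<Longrightarrow> f \<in> Hom C (Cod C u) (Dom C v) \<Longrightarrow>
      \<Phi> (Dom C u) (Cod C v) (v \<cdot> f \<cdot> u) = AMap q v \<cdot> \<Phi> (Cod C u) (Dom C v) f \<cdot> u"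
    using q unfolding right_adjoint_def full_subcat_simps inclusion_simps by blast
  have qB: "OMap q A \<in> B" and qId: "AMap q (Id C A) = Id C (OMap q A)" if "A \<in> Obj C" for A
    using q_functor that unfolding is_functor_def by auto
  have qH: "AMap q v \<in> Hom C (OMap q A) (OMap q A')" if v: "v \<in> Hom C A A'" for v A A'
  proof -
    have "AMap q v \<in> Hom (full_subcat C B) (OMap q A) (OMap q A')"
      using q_functor HomD[OF v] unfolding is_functor_def by auto
    then show ?thesis using Hom_full_subcat qB HomD[OF v] by simp
  qed
  have bij': "bij_betw (\<Phi> X Y) (Hom C X Y) (Hom C X (OMap q Y))" if "X \<in> B" "Y \<in> Obj C" for X Y
    using bij[OF that] Hom_full_subcat that qB by simp
  \<comment> \<open>Joint naturality is split into one law for each variable by placing an identity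
    in the other.\<close>
  have nat_left: "\<Phi> X Y (f \<cdot> u) = \<Phi> X' Y f \<cdot> u"
    if u: "u \<in> Hom C X X'" "X \<in> B" "X' \<in> B" and f: "f \<in> Hom C X' Y" for u f X X' Y
  proof -
    have Y: "Id C Y \<in> Hom C Y Y" using Id_Hom HomD[OF f] by simp
    have "\<Phi> X' Y f \<in> Hom C X' (OMap q Y)"
      using bij' u f HomD[OF f] bij_betwE by blast
    then show ?thesis
      using nat[of u "Id C Y" f] HomD[OF u(1)] HomD[OF Y] u f qId Id_left by simp
  qed
  have nat_right: "\<Phi> X Y' (v \<cdot> f) = AMap q v \<cdot> \<Phi> X Y f"
    if v: "v \<in> Hom C Y Y'" and f: "f \<in> Hom C X Y" and X: "X \<in> B" for v f X Y Y'
  proof -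
    have I: "Id C X \<in> Hom C X X" using Id_Hom HomD[OF f] by simp
    have "\<Phi> X Y f \<in> Hom C X (OMap q Y)"
      using bij' X f HomD[OF f] bij_betwE by blast
    then show ?thesis
      using nat[of "Id C X" v f] HomD[OF I] HomD[OF v] X f Id_right[OF Comp_Hom[OF f v]]
        Id_right[OF Comp_Hom[OF _ qH[OF v]]] by simp
  qed
  define c where "c A = inv_into (Hom C (OMap q A) A) (\<Phi> (OMap q A) A) (Id C (OMap q A))" for A
  have cH: "c A \<in> Hom C (OMap q A) A" and \<Phi>c: "\<Phi> (OMap q A) A (c A) = Id C (OMap q A)"
    if A: "A \<in> Obj C" for A
  proof -
    have "Id C (OMap q A) \<in> Hom C (OMap q A) (OMap q A)"
      using Id_Hom qB[OF A] B by blast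
    then have "Id C (OMap q A) \<in> \<Phi> (OMap q A) A ` Hom C (OMap q A) A"
      using bij'[OF qB[OF A] A] bij_betw_imp_surj_on by fast
    from inv_into_into[OF this] f_inv_into_f[OF this]
    show "c A \<in> Hom C (OMap q A) A" "\<Phi> (OMap q A) A (c A) = Id C (OMap q A)"
      unfolding c_def by simp_all
  qed
  have \<Phi>cu: "\<Phi> X A (c A \<cdot> u) = u" if "A \<in> Obj C" "X \<in> B" "u \<in> Hom C X (OMap q A)" for A X u
    using nat_left[OF that(3,2) qB[OF that(1)] cH[OF that(1)]] \<Phi>c[OF that(1)] Id_left[OF that(3)] by simp
  have "coreflection B A (OMap q A) (c A)" if A: "A \<in> Obj C" for A
    unfolding coreflection_def
  proof (intro conjI ballI)
    fix Q g assume Q: "Q \<in> B" and g: "g \<in> Hom C Q A"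
    note b = bij'[OF Q A]
    have \<Phi>g: "\<Phi> Q A g \<in> Hom C Q (OMap q A)" using b g bij_betwE by blast
    then have "c A \<cdot> \<Phi> Q A g = g"
      using \<Phi>cu[OF A Q \<Phi>g] Comp_Hom[OF \<Phi>g cH[OF A]] g b unfolding bij_betw_def inj_on_def by blast
    then show "\<exists>!g'. g' \<in> Hom C Q (OMap q A) \<and> c A \<cdot> g' = g"
      using \<Phi>g \<Phi>cu[OF A Q] by metis
  qed (use A qB cH in auto)
  moreover have "c A' \<cdot> AMap q v = v \<cdot> c A" if v: "v \<in> Hom C A A'" for v A A'
  proof -
    have A: "A \<in> Obj C" and A': "A' \<in> Obj C" using HomD[OF v] by auto
    note b = bij'[OF qB[OF A] A']
    have "\<Phi> (OMap q A) A' (c A' \<cdot> AMap q v) = \<Phi> (OMap q A) A' (v \<cdot> c A)"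
      using \<Phi>cu[OF A' qB[OF A] qH[OF v]] nat_right[OF v cH[OF A] qB[OF A]] \<Phi>c[OF A]
        Id_right[OF qH[OF v]] by simp
    then show ?thesis
      using Comp_Hom[OF qH[OF v] cH[OF A']] Comp_Hom[OF cH[OF A] v] b
      unfolding bij_betw_def inj_on_def by blast
  qed
  ultimately show ?thesis using that qH by blast
qed

text \<open>The comparison is the lift of one counit along the other. Its inverse is the lift in the
  opposite direction, and both invertibility and naturality follow from uniqueness of lifts.\<close>

lemma right_adjoint_unique:
  assumes B: "B \<subseteq> Obj C" and p: "right_adjoint (full_subcat C B) C inclusion p"
    and q: "right_adjoint (full_subcat C B) C inclusion q"
  shows "naturally_isomorphic C (full_subcat C B) p q"
proof -
  obtain c where c: "\<And>A. A \<in> Obj C \<Longrightarrow> coreflection B A (OMap p A) (c A)"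
    and cn: "\<And>v A A'. v \<in> Hom C A A' \<Longrightarrow> AMap p v \<in> Hom C (OMap p A) (OMap p A') \<and> c A' \<cdot> AMap p v = v \<cdot> c A"
    using coreflections_of_right_adjoint[OF B p] by blast
  obtain d where d: "\<And>A. A \<in> Obj C \<Longrightarrow> coreflection B A (OMap q A) (d A)"
    and dn: "\<And>v A A'. v \<in> Hom C A A' \<Longrightarrow> AMap q v \<in> Hom C (OMap q A) (OMap q A') \<and> d A' \<cdot> AMap q v = v \<cdot> d A"
    using coreflections_of_right_adjoint[OF B q] by blast
  have pB: "OMap p A \<in> B" and cH: "c A \<in> Hom C (OMap p A) A" if "A \<in> Obj C" for A
    using c[OF that] unfolding coreflection_def by auto
  have qB: "OMap q A \<in> B" and dH: "d A \<in> Hom C (OMap q A) A" if "A \<in> Obj C" for A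
    using d[OF that] unfolding coreflection_def by auto
  have "\<forall>A\<in>Obj C. \<exists>e. e \<in> Hom C (OMap p A) (OMap q A) \<and> d A \<cdot> e = c A"
    using coreflection_factor[OF d pB cH] by metis
  then obtain \<eta> where \<eta>: "\<And>A. A \<in> Obj C \<Longrightarrow> \<eta> A \<in> Hom C (OMap p A) (OMap q A)"
    and d\<eta>: "\<And>A. A \<in> Obj C \<Longrightarrow> d A \<cdot> \<eta> A = c A" by metis
  have iso: "is_isomorphism (full_subcat C B) (\<eta> A)" if A: "A \<in> Obj C" for A
  proof -
    obtain e where e: "e \<in> Hom C (OMap q A) (OMap p A)" "c A \<cdot> e = d A"
      using coreflection_factor[OF c[OF A] qB[OF A] dH[OF A]] .
    have "e \<cdot> \<eta> A = Id C (OMap p A)"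
      using coreflection_unique[OF c[OF A] pB[OF A] Comp_Hom[OF \<eta>[OF A] e(1)] Id_Hom]
        Comp_assoc[OF \<eta>[OF A] e(1) cH[OF A]] e d\<eta>[OF A] Id_right[OF cH[OF A]] HomD[OF e(1)] by simp
    moreover have "\<eta> A \<cdot> e = Id C (OMap q A)"
      using coreflection_unique[OF d[OF A] qB[OF A] Comp_Hom[OF e(1) \<eta>[OF A]] Id_Hom]
        Comp_assoc[OF e(1) \<eta>[OF A] dH[OF A]] e d\<eta>[OF A] Id_right[OF dH[OF A]] HomD[OF e(1)] by simp
    ultimately show ?thesis
      unfolding is_isomorphism_def
      using e HomD[OF \<eta>[OF A]] pB[OF A] qB[OF A] Hom_full_subcat by auto
  qed
  show ?thesis
    unfolding naturally_isomorphic_def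
  proof (intro exI[of _ \<eta>] conjI ballI)
    fix A assume A: "A \<in> Obj C"
    show "\<eta> A \<in> Hom (full_subcat C B) (OMap p A) (OMap q A)"
      using \<eta>[OF A] Hom_full_subcat pB qB A by simp
    show "is_isomorphism (full_subcat C B) (\<eta> A)" using iso[OF A] .
  next
    fix f assume f': "f \<in> Arr C"
    define A A' where "A = Dom C f" and "A' = Cod C f"
    have f: "f \<in> Hom C A A'" using Arr_Hom[OF f'] by (simp add: A_def A'_def)
    have A: "A \<in> Obj C" and A': "A' \<in> Obj C" using HomD[OF f] by auto
    note cf = cn[OF f]
    note df = dn[OF f]
    have "AMap q f \<cdot> \<eta> A = \<eta> A' \<cdot> AMap p f"
    proof (rule coreflection_unique[OF d[OF A'] pB[OF A]])
      show "AMap q f \<cdot> \<eta> A \<in> Hom C (OMap p A) (OMap q A')" using Comp_Hom \<eta>[OF A] df by blast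
      show "\<eta> A' \<cdot> AMap p f \<in> Hom C (OMap p A) (OMap q A')" using Comp_Hom \<eta>[OF A'] cf by blast
      show "d A' \<cdot> (AMap q f \<cdot> \<eta> A) = d A' \<cdot> (\<eta> A' \<cdot> AMap p f)"
        using Comp_assoc[OF \<eta>[OF A] conjunct1[OF df] dH[OF A']] df Comp_assoc[OF \<eta>[OF A] dH[OF A] f]
          d\<eta>[OF A] Comp_assoc[OF conjunct1[OF cf] \<eta>[OF A'] dH[OF A']] d\<eta>[OF A'] cf by simp
    qed
    then show "AMap q f \<cdot>\<^bsub>full_subcat C B\<^esub> \<eta> (Dom C f) = \<eta> (Cod C f) \<cdot>\<^bsub>full_subcat C B\<^esub> AMap p f"
      by (simp add: A_def A'_def)
  qed
qed

end

text \<open>Let \<open>k\<close> be the coreflection of the cokernel \<open>P\<close>. The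
  projection \<open>p\<close> lifts to \<open>s\<close>, and \<open>s \<cdot> f\<close> is zero
  because \<open>X\<close> lies in \<open>B\<close> and \<open>k\<close> does not distinguish the
  two arrows. Hence \<open>s\<close> descends to a section \<open>r\<close> of \<open>k\<close>, and
  \<open>r \<cdot> k = 1\<close> again by uniqueness, so \<open>P\<close> is isomorphic to an object
  of \<open>B\<close>.\<close>

lemma (in abelian_category) coreflective_closed_under_cokernels:
  assumes "coreflective C B"
  shows "closed_under_cokernels C B"
  unfolding closed_under_cokernels_def
proof (intro allI impI)
  fix f p assume fp: "Dom C f \<in> B \<and> Cod C f \<in> B \<and> is_cokernel C f p"
  define X Y P where "X = Dom C f" and "Y = Cod C f" and "P = Cod C p"
  have XB: "X \<in> B" and YB: "Y \<in> B" using fp by (auto simp: X_def Y_def)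
  have p: "is_cokernel C f p" using fp by simp
  have f: "f \<in> Hom C X Y"
    using p Arr_Hom unfolding is_cokernel_def X_def Y_def by blast
  have pH: "p \<in> Hom C Y P" using cokernel_Hom[OF p f] by (simp add: P_def)
  have P: "P \<in> Obj C" using HomD[OF pH] by simp
  note epi = cokernel_epi[OF p f]
  from assms obtain q where sub: "is_subcategory C B"
    and q: "right_adjoint (full_subcat C B) C inclusion q" unfolding coreflective_def by blast
  then have BO: "B \<subseteq> Obj C" unfolding is_subcategory_def by simp
  obtain c where "\<And>A. A \<in> Obj C \<Longrightarrow> coreflection B A (OMap q A) (c A)"
    using coreflections_of_right_adjoint[OF BO q] by metis
  then obtain V k where co: "coreflection B P V k" using P by blast
  then have VB: "V \<in> B" and k: "k \<in> Hom C V P" unfolding coreflection_def by auto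
  obtain s where s: "s \<in> Hom C Y V" "k \<cdot> s = p" using coreflection_factor[OF co YB pH] .
  have "s \<cdot> f = zero X V"
  proof (rule coreflection_unique[OF co XB Comp_Hom[OF f s(1)] zero_Hom])
    show "k \<cdot> (s \<cdot> f) = k \<cdot> zero X V"
      using Comp_assoc[OF f s(1) k] s cokernel_zero[OF p f] comp_zero[OF k] HomD[OF f]
      by (simp add: P_def)
  qed (use HomD[OF f] HomD[OF k] in auto)
  then obtain r where r: "r \<in> Hom C P V" "r \<cdot> p = s" using cokernel_factor[OF p f pH s(1)] by blast
  have kr: "k \<cdot> r = Id C P"
    using epiD[OF epi pH Comp_Hom[OF r(1) k] Id_Hom[OF P]] Comp_assoc[OF pH r(1) k] r s
      Id_left[OF pH] by simp
  have "r \<cdot> k = Id C V"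
    using coreflection_unique[OF co VB Comp_Hom[OF k r(1)] Id_Hom] Comp_assoc[OF k r(1) k] kr
      Id_left[OF k] Id_right[OF k] HomD[OF k] by simp
  then have "isomorphic_objects C V P"
    unfolding isomorphic_objects_def using isomorphismI[OF k r(1) _ kr] k by blast
  then show "Cod C p \<in> B" using sub VB unfolding is_subcategory_def P_def by blast
qed

section \<open>Generated and presented objects\<close>

text \<open>Cocompleteness and \<open>Sum\<close> only speak of index sets over the type underlying
  \<open>\<kappa>\<close>, whereas the canonical coproduct is indexed by pairs of an object and an
  arrow.\<close>

lemma small_reindex:
  assumes "Card_order \<kappa>" and "small (\<kappa> :: 'k rel) I"
  obtains J :: "'k set" and g where "small \<kappa> J" "bij_betw g J I"
proof -
  have "|I| \<le>o |Field \<kappa>|"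
    using assms ordLess_imp_ordLeq ordLeq_ordIso_trans ordIso_symmetric card_of_Field_ordIso
    unfolding small_def by blast
  then obtain f :: "_ \<Rightarrow> 'k" where f: "inj_on f I" using card_of_ordLeq[of I "Field \<kappa>"] by blast
  have "small \<kappa> (f ` I)"
    using card_of_image assms(2) ordLeq_ordLess_trans unfolding small_def by blast
  moreover have "bij_betw (inv_into I f) (f ` I) I"
    using f by (simp add: bij_betw_inv_into inj_on_imp_bij_betw)
  ultimately show ?thesis using that by blast
qed

lemma (in category) coproduct_reindex:
  assumes X: "is_coproduct C I D X c" and g: "bij_betw g J I"
  shows "is_coproduct C J (\<lambda>j. D (g j)) X (\<lambda>j. c (g j))"
proof (rule coproductI)
  show "X \<in> Obj C" using X unfolding is_coproduct_def by blast
  show "c (g j) \<in> Hom C (D (g j)) X" if "j \<in> J" for j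
    using coproduct_inj[OF X bij_betw_apply[OF g that]] .
  show "\<exists>h\<in>Hom C X Y. \<forall>j\<in>J. h \<cdot> c (g j) = d j"
    if Y: "Y \<in> Obj C" and d: "\<And>j. j \<in> J \<Longrightarrow> d j \<in> Hom C (D (g j)) Y" for Y d
  proof -
    have inv: "inv_into J g i \<in> J" "g (inv_into J g i) = i" if "i \<in> I" for i
      using g that inv_into_into[of i g J] f_inv_into_f[of i g J] by (auto simp: bij_betw_def)
    obtain h where h: "h \<in> Hom C X Y" "\<And>i. i \<in> I \<Longrightarrow> h \<cdot> c i = d (inv_into J g i)"
      using coproduct_factor[OF X Y, of "\<lambda>i. d (inv_into J g i)"] d inv by metis
    have "h \<cdot> c (g j) = d j" if "j \<in> J" for j
      using h(2)[OF bij_betw_apply[OF g that]] bij_betw_inv_into_left[OF g that] by simp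
    then show ?thesis using h(1) by blast
  qed
  show "h = h'" if h: "h \<in> Hom C X Y" "h' \<in> Hom C X Y"
    and eq: "\<And>j. j \<in> J \<Longrightarrow> h \<cdot> c (g j) = h' \<cdot> c (g j)" for Y h h'
    using coproduct_unique[OF X h] eq g by (metis bij_betw_imp_surj_on imageE)
qed

context category
begin

lemma coproduct_singleton:
  assumes "A \<in> Obj C"
  shows "is_coproduct C {i} (\<lambda>_. A) A (\<lambda>_. Id C A)"
proof (rule coproductI)
  show "\<exists>h\<in>Hom C A Y. \<forall>i\<in>{i}. h \<cdot> Id C A = d i" if "\<And>j. j \<in> {i} \<Longrightarrow> d j \<in> Hom C A Y" for Y d
    using that[of i] Id_right[of "d i"] by auto
  show "h = h'" if "h \<in> Hom C A Y" "h' \<in> Hom C A Y"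
    "\<And>j. j \<in> {i} \<Longrightarrow> h \<cdot> Id C A = h' \<cdot> Id C A" for Y h h'
    using that(3)[of i] Id_right that(1,2) by simp
qed (use assms Id_Hom in auto)

lemma subobjectD:
  assumes "is_subobject C m A"
  shows "m \<in> Hom C (Dom C m) A" "is_mono C m"
  using assms unfolding is_subobject_def is_mono_def Hom_def by simp_all

lemma sub_incl_eq:
  assumes "is_mono C s" "s \<in> Hom C S A" "i \<in> Hom C T S" "s \<cdot> i = t"
  shows "sub_incl C t s = i"
proof -
  have t: "Dom C t = T" using HomD(2)[OF Comp_Hom[OF assms(3,2)]] assms(4) by simp
  show ?thesis
    unfolding sub_incl_def t HomD(2)[OF assms(2)]
  proof (rule the_equality)
    show "x = i" if "x \<in> Hom C T S \<and> s \<cdot> x = t" for x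
      by (rule monoD[OF assms(1,2) _ assms(3)]) (use that assms(4) in simp_all)
  qed (use assms in simp)
qed

end

context abelian_category
begin

lemma coker_Hom: "f \<in> Hom C A B \<Longrightarrow> coker C f \<in> Hom C B (quot C f)"
  using cokernel_Hom[OF is_cokernel_coker] HomD(1) unfolding quot_def by blast

lemma coker_zero: "f \<in> Hom C A B \<Longrightarrow> coker C f \<cdot> f = zero A (quot C f)"
  using cokernel_zero[OF is_cokernel_coker] HomD(1) unfolding quot_def by blast

lemma coker_epi: "f \<in> Hom C A B \<Longrightarrow> is_epi C (coker C f)"
  using cokernel_epi[OF is_cokernel_coker] HomD(1) by blast

text \<open>The definite description in \<open>quot_sub\<close> is justified:
  \<open>coker C t \<cdot> s\<close> kills \<open>i\<close>, which gives existence, and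
  \<open>coker C i\<close> is epi, which gives uniqueness.\<close>

lemma quot_sub_props:
  assumes s: "is_mono C s" "s \<in> Hom C S A" and i: "i \<in> Hom C T S" "s \<cdot> i = t"
  shows quot_sub_Hom: "quot_sub C t s \<in> Hom C (quot C i) (quot C t)"
    and quot_sub_coker: "quot_sub C t s \<cdot> coker C i = coker C t \<cdot> s"
proof -
  have t: "t \<in> Hom C T A" using Comp_Hom[OF i(1) s(2)] i(2) by simp
  note p = coker_Hom[OF t]
  note \<pi> = coker_Hom[OF i(1)]
  have ps: "coker C t \<cdot> s \<in> Hom C S (quot C t)" using Comp_Hom[OF s(2) p] .
  have "coker C t \<cdot> s \<cdot> i = zero T (quot C t)"
    using Comp_assoc[OF i(1) s(2) p] i(2) coker_zero[OF t] by simp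
  then obtain h where h: "h \<in> Hom C (quot C i) (quot C t)" "h \<cdot> coker C i = coker C t \<cdot> s"
    using cokernel_factor[OF is_cokernel_coker[OF HomD(1)[OF i(1)]] i(1) \<pi> ps] by blast
  have "quot_sub C t s = h"
    unfolding quot_sub_def sub_incl_eq[OF s i]
  proof (rule the_equality)
    show "x = h" if "x \<in> Hom C (quot C i) (quot C t) \<and> x \<cdot> coker C i = coker C t \<cdot> s" for x
      by (rule epiD[OF coker_epi[OF i(1)] \<pi> _ h(1)]) (use that h(2) in simp_all)
  qed (use h in simp)
  with h show "quot_sub C t s \<in> Hom C (quot C i) (quot C t)"
    "quot_sub C t s \<cdot> coker C i = coker C t \<cdot> s" by simp_all
qed

lemma PresI:
  assumes "f \<in> Hom C Y' Y" "Y' \<in> Sum \<kappa> C U" "Y \<in> Sum \<kappa> C U" "is_cokernel C f p" "p \<in> Hom C Y Q"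
  shows "Q \<in> Pres \<kappa> C U"
proof -
  have Q: "Id C Q \<in> Hom C Q Q" using Id_Hom HomD[OF assms(5)] by simp
  then have "is_isomorphism C (Id C Q)" using isomorphismI[OF Q Q] Id_left[OF Q] by simp
  then show ?thesis
    unfolding Pres_def isomorphic_objects_def
    using assms HomD[OF assms(1)] HomD[OF assms(5)] Q by auto
qed

text \<open>The isomorphism allowed in \<open>Pres\<close> is absorbed into the cokernel arrow, so
  that \<open>Q\<close> itself becomes the target of a cokernel.\<close>

lemma PresE:
  assumes "Q \<in> Pres \<kappa> C U"
  obtains f Y' Y p where "f \<in> Hom C Y' Y" "Y' \<in> Sum \<kappa> C U" "Y \<in> Sum \<kappa> C U" "is_cokernel C f p"
    "p \<in> Hom C Y Q"
proof -
  obtain f p where D: "Dom C f \<in> Sum \<kappa> C U" "Cod C f \<in> Sum \<kappa> C U" and p: "is_cokernel C f p"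
    and "isomorphic_objects C (Cod C p) Q" using assms unfolding Pres_def by blast
  then obtain u where u: "u \<in> Hom C (Cod C p) Q" "is_isomorphism C u"
    unfolding isomorphic_objects_def by blast
  obtain v where v: "v \<in> Hom C Q (Cod C p)" "v \<cdot> u = Id C (Cod C p)" "u \<cdot> v = Id C Q"
    using isomorphismE[OF u(2,1)] .
  have "f \<in> Arr C" using p unfolding is_cokernel_def by blast
  from Arr_Hom[OF this] obtain Y' Y where f: "f \<in> Hom C Y' Y" and Y: "Y' \<in> Sum \<kappa> C U" "Y \<in> Sum \<kappa> C U"
    using D by blast
  note pH = cokernel_Hom[OF p f]
  have up: "u \<cdot> p \<in> Hom C Y Q" using Comp_Hom[OF pH u(1)] .
  have "is_cokernel C f (u \<cdot> p)"
  proof (rule cokernelI[OF f up epi_comp[OF cokernel_epi[OF p f] split_epi[OF u(1) v(1,3)] pH u(1)]])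
    show "u \<cdot> p \<cdot> f = zero Y' Q"
      using Comp_assoc[OF f pH u(1)] cokernel_zero[OF p f] comp_zero[OF u(1)] HomD[OF f] by simp
    fix X g assume g: "g \<in> Hom C Y X" "g \<cdot> f = zero Y' X"
    then obtain h where h: "h \<in> Hom C (Cod C p) X" "h \<cdot> p = g"
      using cokernel_factor[OF p f pH] by blast
    have "(h \<cdot> v) \<cdot> (u \<cdot> p) = h \<cdot> (v \<cdot> u \<cdot> p)"
      using Comp_assoc[OF up v(1) h(1)] Comp_assoc[OF pH u(1) v(1)] by simp
    then have "(h \<cdot> v) \<cdot> (u \<cdot> p) = g" using v Id_left[OF pH] h by simp
    then show "\<exists>h\<in>Hom C Q X. h \<cdot> (u \<cdot> p) = g" using Comp_Hom[OF v(1) h(1)] by blast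
  qed
  with f Y up show ?thesis using that by blast
qed

lemma is_subcategory_Pres: "is_subcategory C (Pres \<kappa> C U)"
  unfolding is_subcategory_def
proof (intro conjI allI impI subsetI)
  show "X \<in> Obj C" if "X \<in> Pres \<kappa> C U" for X
    using PresE[OF that] HomD(5) by metis
  fix X Y assume XY: "X \<in> Pres \<kappa> C U \<and> isomorphic_objects C X Y"
  then obtain u where u: "u \<in> Hom C X Y" "is_isomorphism C u"
    unfolding isomorphic_objects_def by blast
  obtain v where v: "v \<in> Hom C Y X" "v \<cdot> u = Id C X" "u \<cdot> v = Id C Y"
    using isomorphismE[OF u(2,1)] .
  obtain f p w where fp: "Dom C f \<in> Sum \<kappa> C U" "Cod C f \<in> Sum \<kappa> C U" "is_cokernel C f p"
    and w: "w \<in> Hom C (Cod C p) X" "is_isomorphism C w"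
    using XY unfolding Pres_def isomorphic_objects_def by blast
  obtain x where x: "x \<in> Hom C X (Cod C p)" "x \<cdot> w = Id C (Cod C p)" "w \<cdot> x = Id C X"
    using isomorphismE[OF w(2,1)] .
  have uw: "u \<cdot> w \<in> Hom C (Cod C p) Y" "x \<cdot> v \<in> Hom C Y (Cod C p)"
    using Comp_Hom[OF w(1) u(1)] Comp_Hom[OF v(1) x(1)] .
  have "(x \<cdot> v) \<cdot> (u \<cdot> w) = Id C (Cod C p)"
    using Comp_assoc[OF uw(1) v(1) x(1)] Comp_assoc[OF w(1) u(1) v(1)] v x Id_left[OF w(1)] by simp
  moreover have "(u \<cdot> w) \<cdot> (x \<cdot> v) = Id C Y"
    using Comp_assoc[OF uw(2) w(1) u(1)] Comp_assoc[OF v(1) x(1) w(1)] v x Id_left[OF v(1)] by simp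
  ultimately have "is_isomorphism C (u \<cdot> w)" using isomorphismI[OF uw] by blast
  then show "Y \<in> Pres \<kappa> C U"
    using fp uw(1) unfolding Pres_def isomorphic_objects_def by blast
qed

end

section \<open>Coproducts and traces in AB3 categories\<close>

locale AB3_category = abelian_category C add zero
  for C :: "('o, 'a) cat" (structure) and add zero +
  fixes \<kappa> :: "'k rel" and U :: "'o set"
  assumes Cinfinite: "Cinfinite \<kappa>" and regular: "regularCard \<kappa>"
    and locally_small: "locally_small \<kappa> C" and cocomplete: "cocomplete \<kappa> C"
    and U_Obj: "U \<subseteq> Obj C" and small_U: "small \<kappa> U"
begin

abbreviation "tr A \<equiv> trace \<kappa> C U A"
abbreviation "tr2 A \<equiv> trace2 \<kappa> C U A"

lemma ex_coproduct:
  assumes I: "small \<kappa> I" and D: "\<And>i. i \<in> I \<Longrightarrow> D i \<in> Obj C"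
  shows "\<exists>X c. is_coproduct C I D X c"
proof -
  obtain J :: "'k set" and g where J: "small \<kappa> J" and g: "bij_betw g J I"
    using small_reindex[OF _ I] Cinfinite by blast
  define E where "E j = D (g j)" for j
  have E: "E j \<in> Obj C" if "j \<in> J" for j
    using D bij_betw_apply[OF g that] by (simp add: E_def)
  \<comment> \<open>The discrete category on \<open>J\<close>: every index is its own identity
    arrow. Only equal arrows are composable, so returning the first argument is a correct
    composition.\<close>
  define Jc :: "('k, 'k) cat" where
    "Jc = \<lparr>Obj = J, Arr = J, Dom = (\<lambda>j. j), Cod = (\<lambda>j. j), Id = (\<lambda>j. j), Comp = (\<lambda>i j. i)\<rparr>"
  define F where "F = \<lparr>OMap = E, AMap = (\<lambda>j. Id C (E j))\<rparr>"
  have "category Jc" by unfold_locales (auto simp: Jc_def Hom_def)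
  moreover have "is_functor Jc C F"
    unfolding is_functor_def using E Id_Hom Id_left[OF Id_Hom] by (auto simp: Jc_def F_def)
  moreover have "small \<kappa> (Obj Jc)" "small \<kappa> (Arr Jc)" using J by (simp_all add: Jc_def)
  ultimately obtain X c where X: "is_colimit Jc C F X c"
    using cocomplete unfolding cocomplete_def by blast
  have cocone: "is_cocone Jc C F Y d \<longleftrightarrow> Y \<in> Obj C \<and> (\<forall>j\<in>J. d j \<in> Hom C (E j) Y)" for Y d
    unfolding is_cocone_def using Id_right by (auto simp: Jc_def F_def)
  have "is_coproduct C J E X c"
    using X unfolding is_colimit_def cocone is_coproduct_def by (auto simp: Jc_def)
  from coproduct_reindex[OF this bij_betw_inv_into[OF g]]
  have "is_coproduct C I (\<lambda>i. E (inv_into J g i)) X (\<lambda>i. c (inv_into J g i))" .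
  moreover have "E (inv_into J g i) = D i" if "i \<in> I" for i
    using bij_betw_inv_into_right[OF g that] by (simp add: E_def)
  ultimately have "is_coproduct C I D X (\<lambda>i. c (inv_into J g i))"
    unfolding is_coproduct_def by simp
  then show ?thesis by blast
qed

lemma Sum_coproduct:
  assumes I: "small \<kappa> I" and D: "\<And>i. i \<in> I \<Longrightarrow> D i \<in> U" and X: "is_coproduct C I D X c"
  shows "X \<in> Sum \<kappa> C U"
proof -
  obtain J :: "'k set" and g where J: "small \<kappa> J" and g: "bij_betw g J I"
    using small_reindex[OF _ I] Cinfinite by blast
  have "\<forall>j\<in>J. D (g j) \<in> U" using D bij_betw_apply[OF g] by blast
  then show ?thesis
    unfolding Sum_def using J coproduct_reindex[OF X g] by (intro CollectI exI conjI)
qed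

lemma U_Sum:
  assumes "X \<in> U"
  shows "X \<in> Sum \<kappa> C U"
proof (rule Sum_coproduct[OF _ _ coproduct_singleton])
  have "Cfinite |{()}|" unfolding cfinite_def by (simp add: Field_card_of card_of_card_order_on)
  then show "small \<kappa> {()}"
    unfolding small_def using Cfinite_ordLess_Cinfinite Cinfinite by blast
qed (use assms U_Obj in blast)+

lemma Sum_Obj: "Y \<in> Sum \<kappa> C U \<Longrightarrow> Y \<in> Obj C"
  unfolding Sum_def is_coproduct_def by blast

text \<open>Regularity of \<open>\<kappa>\<close> enters here: the index set is a disjoint union of
  small hom-sets over the small set \<open>U\<close>, and must be small itself.\<close>

lemma U_hat_coproduct:
  assumes A: "A \<in> Obj C"
  shows "is_coproduct C (SIGMA X:U. Hom C X A) fst (U_hat C U A) (snd (U_hat_cop C U A))"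
    and "U_hat C U A \<in> Sum \<kappa> C U"
proof -
  have hom: "|Hom C X A| <o \<kappa>" if "X \<in> U" for X
    using locally_small U_Obj A that unfolding locally_small_def small_def by blast
  have "stable \<kappa>"
    using regularCard_stable regular Cinfinite unfolding cinfinite_def by blast
  from stable_elim[OF this small_U[unfolded small_def] hom]
  have small: "small \<kappa> (SIGMA X:U. Hom C X A)" unfolding small_def .
  have "\<exists>X c. is_coproduct C (SIGMA X:U. Hom C X A) fst X c"
    by (rule ex_coproduct[OF small]) (use U_Obj in auto)
  then have "\<exists>P. case P of (X, c) \<Rightarrow> is_coproduct C (SIGMA X:U. Hom C X A) fst X c" by simp
  from someI_ex[OF this, folded U_hat_cop_def]
  show cop: "is_coproduct C (SIGMA X:U. Hom C X A) fst (U_hat C U A) (snd (U_hat_cop C U A))"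
    by (simp add: U_hat_def case_prod_beta)
  show "U_hat C U A \<in> Sum \<kappa> C U" by (rule Sum_coproduct[OF small _ cop]) auto
qed

lemma eps_props:
  assumes A: "A \<in> Obj C"
  shows eps_Hom: "eps C U A \<in> Hom C (U_hat C U A) A"
    and eps_inj: "X \<in> U \<Longrightarrow> \<alpha> \<in> Hom C X A \<Longrightarrow> eps C U A \<cdot> snd (U_hat_cop C U A) (X, \<alpha>) = \<alpha>"
proof -
  note cop = U_hat_coproduct(1)[OF A]
  have "\<exists>!h. h \<in> Hom C (U_hat C U A) A \<and>
      (\<forall>i\<in>SIGMA X:U. Hom C X A. h \<cdot> snd (U_hat_cop C U A) i = snd i)"
    by (intro cop[unfolded is_coproduct_def, THEN conjunct2, THEN conjunct2, rule_format] A) auto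
  then have "\<exists>!h. h \<in> Hom C (U_hat C U A) A \<and>
      (\<forall>X\<in>U. \<forall>\<alpha>\<in>Hom C X A. h \<cdot> snd (U_hat_cop C U A) (X, \<alpha>) = \<alpha>)"
    by simp
  from theI'[OF this] show "eps C U A \<in> Hom C (U_hat C U A) A"
    "X \<in> U \<Longrightarrow> \<alpha> \<in> Hom C X A \<Longrightarrow> eps C U A \<cdot> snd (U_hat_cop C U A) (X, \<alpha>) = \<alpha>"
    unfolding eps_def by simp_all
qed

text \<open>Each component \<open>y \<cdot> c i\<close> is an arrow from an object of
  \<open>U\<close> to \<open>A\<close>, hence itself an index of the canonical coproduct. Sending
  \<open>D i\<close> to the copy with that index defines the lift, so objects of \<open>Sum\<close>
  are projective relative to \<open>eps\<close>.\<close>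

lemma eps_lift:
  assumes Y: "Y \<in> Sum \<kappa> C U" and y: "y \<in> Hom C Y A"
  obtains y' where "y' \<in> Hom C Y (U_hat C U A)" "eps C U A \<cdot> y' = y"
proof -
  have A: "A \<in> Obj C" using HomD[OF y] by simp
  obtain I :: "'k set" and D c where D: "\<And>i. i \<in> I \<Longrightarrow> D i \<in> U" and cop: "is_coproduct C I D Y c"
    using Y unfolding Sum_def by blast
  define d where "d i = snd (U_hat_cop C U A) (D i, y \<cdot> c i)" for i
  have yc: "y \<cdot> c i \<in> Hom C (D i) A" if "i \<in> I" for i
    using Comp_Hom[OF coproduct_inj[OF cop that] y] .
  have d: "d i \<in> Hom C (D i) (U_hat C U A)" if "i \<in> I" for i
    using coproduct_inj[OF U_hat_coproduct(1)[OF A], of "(D i, y \<cdot> c i)"] D yc that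
    by (simp add: d_def)
  obtain y' where y': "y' \<in> Hom C Y (U_hat C U A)" "\<And>i. i \<in> I \<Longrightarrow> y' \<cdot> c i = d i"
    using coproduct_factor[OF cop HomD(4)[OF eps_Hom[OF A]] d] by blast
  have "eps C U A \<cdot> y' = y"
  proof (rule coproduct_unique[OF cop Comp_Hom[OF y'(1) eps_Hom[OF A]] y])
    show "eps C U A \<cdot> y' \<cdot> c i = y \<cdot> c i" if "i \<in> I" for i
      using Comp_assoc[OF coproduct_inj[OF cop that] y'(1) eps_Hom[OF A]] y'(2)[OF that]
        eps_inj[OF A D[OF that] yc[OF that]] by (simp add: d_def)
  qed
  with y' show ?thesis using that by blast
qed

lemma GenI: "e \<in> Hom C Y X \<Longrightarrow> is_epi C e \<Longrightarrow> Y \<in> Sum \<kappa> C U \<Longrightarrow> X \<in> Gen \<kappa> C U"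
  unfolding Gen_def using HomD by auto

lemma GenE:
  assumes "X \<in> Gen \<kappa> C U"
  obtains e Y where "e \<in> Hom C Y X" "is_epi C e" "Y \<in> Sum \<kappa> C U"
  using assms Arr_Hom unfolding Gen_def is_epi_def by blast

text \<open>The image \<open>m\<close> of \<open>eps\<close> is the witness. If \<open>d\<close>
  covers a generated subobject \<open>n\<close> by an object of \<open>Sum\<close>, then
  \<open>n \<cdot> d\<close> lifts through \<open>eps\<close>. Writing \<open>m\<close> as the
  kernel of \<open>f\<close>, it follows that \<open>f\<close> kills \<open>n \<cdot> d\<close>,
  hence \<open>n\<close>, so \<open>n\<close> factors through \<open>m\<close>.\<close>

lemma trace_spec:
  assumes A: "A \<in> Obj C"
  shows "is_subobject C (tr A) A \<and> Dom C (tr A) \<in> Gen \<kappa> C U \<and>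
    (\<forall>n. is_subobject C n A \<and> Dom C n \<in> Gen \<kappa> C U \<longrightarrow> sub_le C n (tr A))"
  unfolding trace_def
proof (rule someI_ex)
  obtain J m e where e: "e \<in> Hom C (U_hat C U A) J" "is_epi C e" and m: "m \<in> Hom C J A" "is_mono C m"
    and me: "m \<cdot> e = eps C U A"
    using image_factorization[OF eps_Hom[OF A]] by metis
  have "sub_le C n m" if n: "is_subobject C n A" and gen: "Dom C n \<in> Gen \<kappa> C U" for n
  proof -
    note nH = subobjectD(1)[OF n]
    obtain d Y where d: "d \<in> Hom C Y (Dom C n)" "is_epi C d" and Y: "Y \<in> Sum \<kappa> C U"
      using GenE[OF gen] .
    obtain y where y: "y \<in> Hom C Y (U_hat C U A)" "eps C U A \<cdot> y = n \<cdot> d"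
      using eps_lift[OF Y Comp_Hom[OF d(1) nH]] .
    obtain f where f: "is_kernel C f m" using mono_normal m(2) by blast
    then have fH: "f \<in> Hom C A (Cod C f)"
      using HomD[OF m(1)] unfolding is_kernel_def Hom_def by auto
    have ey: "e \<cdot> y \<in> Hom C Y J" using Comp_Hom[OF y(1) e(1)] .
    have "f \<cdot> n \<cdot> d = f \<cdot> (m \<cdot> (e \<cdot> y))"
      using Comp_assoc[OF d(1) nH fH] Comp_assoc[OF y(1) e(1) m(1)] me y by simp
    also have "\<dots> = zero Y (Cod C f)"
      using Comp_assoc[OF ey m(1) fH] kernel_zero[OF f fH] HomD[OF m(1)] zero_comp[OF ey]
        HomD[OF fH] by simp
    finally have "f \<cdot> n = zero (Dom C n) (Cod C f)"
      using epi_zeroD[OF d(2,1) Comp_Hom[OF nH fH]] by simp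
    then obtain i where "i \<in> Hom C (Dom C n) J" "m \<cdot> i = n"
      using kernel_factor[OF f fH m(1) nH] by blast
    then show ?thesis unfolding sub_le_def using HomD[OF m(1)] by auto
  qed
  then show "\<exists>m. is_subobject C m A \<and> Dom C m \<in> Gen \<kappa> C U \<and>
      (\<forall>n. is_subobject C n A \<and> Dom C n \<in> Gen \<kappa> C U \<longrightarrow> sub_le C n m)"
    using m GenI[OF e U_hat_coproduct(2)[OF A]] HomD[OF m(1)] unfolding is_subobject_def
    by (intro exI[of _ m]) auto
qed

lemma trace_Hom: "A \<in> Obj C \<Longrightarrow> tr A \<in> Hom C (Dom C (tr A)) A"
  and trace_mono: "A \<in> Obj C \<Longrightarrow> is_mono C (tr A)"
  and trace_Gen: "A \<in> Obj C \<Longrightarrow> Dom C (tr A) \<in> Gen \<kappa> C U"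
  using trace_spec subobjectD by blast+

text \<open>The image of \<open>y\<close> is a generated subobject, hence lies below the
  trace.\<close>

lemma trace_factor:
  assumes Y: "Y \<in> Sum \<kappa> C U" and y: "y \<in> Hom C Y A"
  obtains y' where "y' \<in> Hom C Y (Dom C (tr A))" "tr A \<cdot> y' = y"
proof -
  have A: "A \<in> Obj C" using HomD[OF y] by simp
  obtain J m e where e: "e \<in> Hom C Y J" "is_epi C e" and m: "m \<in> Hom C J A" "is_mono C m"
    and me: "m \<cdot> e = y"
    using image_factorization[OF y] by metis
  have "sub_le C m (tr A)"
    using trace_spec[OF A] m GenI[OF e Y] HomD[OF m(1)] unfolding is_subobject_def by blast
  then obtain i where i: "i \<in> Hom C J (Dom C (tr A))" "tr A \<cdot> i = m"
    unfolding sub_le_def using HomD[OF m(1)] by auto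
  have "tr A \<cdot> (i \<cdot> e) = y" using Comp_assoc[OF e(1) i(1) trace_Hom[OF A]] i me by simp
  then show ?thesis using that Comp_Hom[OF e(1) i(1)] by blast
qed

text \<open>The witness is the kernel of the composite from \<open>A\<close> to
  \<open>P = A/tr(A)\<close> and on to \<open>P/tr(P)\<close>, the preimage of
  \<open>tr(P)\<close>.\<close>

lemma trace2_spec:
  assumes A: "A \<in> Obj C"
  shows "is_subobject C (tr2 A) A \<and> sub_le C (tr A) (tr2 A) \<and>
    sub_eq C (quot_sub C (tr A) (tr2 A)) (tr (quot C (tr A)))"
  unfolding trace2_def
proof (rule someI_ex)
  define t T P where "t = tr A" and "T = Dom C t" and "P = quot C t"
  have t: "t \<in> Hom C T A" "is_mono C t" using trace_Hom trace_mono A by (auto simp: t_def T_def)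
  have p: "is_cokernel C t (coker C t)" "coker C t \<in> Hom C A P"
    using is_cokernel_coker HomD(1) coker_Hom t(1) by (auto simp: P_def)
  have P: "P \<in> Obj C" using HomD[OF p(2)] by simp
  define R d D where "R = Dom C (tr P)" and "d = coker C (tr P)" and "D = quot C (tr P)"
  have \<rho>: "tr P \<in> Hom C R P" "is_mono C (tr P)" using trace_Hom trace_mono P by (auto simp: R_def)
  have d: "is_cokernel C (tr P) d" "d \<in> Hom C P D"
    using is_cokernel_coker HomD(1) coker_Hom \<rho>(1) by (auto simp: d_def D_def)
  note \<rho>_ker = mono_kernel_of_cokernel[OF \<rho>(2,1) d(1)]
  have f: "d \<cdot> coker C t \<in> Hom C A D" using Comp_Hom[OF p(2) d(2)] .
  obtain s where s: "is_kernel C (d \<cdot> coker C t) s" using ex_kernel HomD(1)[OF f] by blast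
  define S where "S = Dom C s"
  have sH: "s \<in> Hom C S A" and sm: "is_mono C s" using kernel_props[OF s f] by (auto simp: S_def)
  have "d \<cdot> coker C t \<cdot> t = zero T D"
    using Comp_assoc[OF t(1) p(2) d(2)] cokernel_zero[OF p(1) t(1)] comp_zero[OF d(2)]
      HomD[OF t(1)] HomD[OF p(2)] by simp
  then obtain i where i: "i \<in> Hom C T S" "s \<cdot> i = t"
    using kernel_factor[OF s f sH t(1)] by blast
  define h where "h = quot_sub C t s"
  have h: "h \<in> Hom C (quot C i) P" "h \<cdot> coker C i = coker C t \<cdot> s"
    using quot_sub_props[OF sm sH i] by (auto simp: h_def P_def)
  \<comment> \<open>\<open>S/T\<close> is a kernel of \<open>d\<close>. So is \<open>tr P\<close>,
    being mono with cokernel \<open>d\<close>; hence the two agree as subobjects of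
    \<open>P\<close>.\<close>
  have h_ker: "is_kernel C d h"
    using kernel_on_quotient[OF t(2,1) p s f sH d(2) refl i is_cokernel_coker[OF HomD(1)[OF i(1)]]
        coker_Hom[OF i(1)] h] .
  have "d \<cdot> h = zero (quot C i) D" "d \<cdot> tr P = zero R D"
    using kernel_zero[OF h_ker d(2)] kernel_zero[OF \<rho>_ker d(2)] HomD(2)[OF h(1)] HomD(2)[OF \<rho>(1)]
    by simp_all
  then obtain x y where "x \<in> Hom C R (quot C i)" "h \<cdot> x = tr P" "y \<in> Hom C (quot C i) R" "tr P \<cdot> y = h"
    using kernel_factor[OF h_ker d(2) h(1) \<rho>(1)] kernel_factor[OF \<rho>_ker d(2) \<rho>(1) h(1)] by metis
  then have "sub_eq C h (tr P)"
    unfolding sub_eq_def sub_le_def HomD(2)[OF h(1)] HomD(2)[OF \<rho>(1)] by blast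
  moreover have "sub_le C t s"
    unfolding sub_le_def using i HomD[OF t(1)] HomD[OF sH] by auto
  ultimately show "\<exists>s. is_subobject C s A \<and> sub_le C (tr A) s \<and>
      sub_eq C (quot_sub C (tr A) s) (tr (quot C (tr A)))"
    using sm HomD[OF sH] unfolding is_subobject_def h_def t_def P_def by blast
qed

end
section \<open>The canonical presentation of an object\<close>

context AB3_category
begin

lemma trace2_props:
  assumes A: "A \<in> Obj C"
  shows trace2_Hom: "tr2 A \<in> Hom C (Dom C (tr2 A)) A" and trace2_mono: "is_mono C (tr2 A)"
    and trace_le_trace2: "\<exists>i\<in>Hom C (Dom C (tr A)) (Dom C (tr2 A)). tr2 A \<cdot> i = tr A"
    and trace2_quot: "sub_eq C (quot_sub C (tr A) (tr2 A)) (tr (quot C (tr A)))"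
  using trace2_spec[OF A] subobjectD unfolding sub_le_def by blast+

text \<open>Here \<open>W = U_hat/tr(Ker \<epsilon>)\<close>, \<open>V = U_hat/tr\<^sup>2(Ker \<epsilon>)\<close>, \<open>N = Ker \<epsilon>/tr\<^sup>2(Ker \<epsilon>)\<close>, and \<open>H\<close> is the
  inclusion of \<open>tr\<^sup>2(Ker \<epsilon>)/tr(Ker \<epsilon>)\<close> into \<open>W\<close>. The arrow \<open>a\<close> is a weak coreflection of \<open>A\<close>
  on presented objects, and \<open>r\<close> kills exactly
  the obstruction to uniqueness.\<close>

lemma canonical_presentation:
  assumes A: "A \<in> Obj C"
  defines "\<tau> \<equiv> tr_Ker_eps \<kappa> C U A" and "\<tau>2 \<equiv> tr2_Ker_eps \<kappa> C U A"
  defines "W \<equiv> quot C \<tau>" and "V \<equiv> quot C \<tau>2" and "H \<equiv> quot_sub C \<tau> \<tau>2"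
    and "N \<equiv> quot C (tr2 (Dom C (ker C (eps C U A))))"
  obtains r a b n Q where
    "a \<in> Hom C W A" "r \<in> Hom C W V" "b \<in> Hom C V A" "b \<cdot> r = a"
    "H \<in> Hom C Q W" "is_kernel C r H" "is_cokernel C H r"
    "n \<in> Hom C N V" "is_kernel C b n"
    "W \<in> Pres \<kappa> C U" "W \<in> Gen \<kappa> C U" "Q \<in> Gen \<kappa> C U"
    "\<forall>Y\<in>Sum \<kappa> C U. \<forall>y\<in>Hom C Y W. a \<cdot> y = zero Y A \<longrightarrow> r \<cdot> y = zero Y V"
    "\<forall>X\<in>Pres \<kappa> C U. \<forall>x\<in>Hom C X A. \<exists>x'\<in>Hom C X W. a \<cdot> x' = x"
proof -
  define E k K where "E = U_hat C U A" and "k = ker C (eps C U A)" and "K = Dom C k"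
  note ep = eps_Hom[OF A, folded E_def]
  have k_ker: "is_kernel C (eps C U A) k" using is_kernel_ker HomD(1)[OF ep] by (simp add: k_def)
  have kH: "k \<in> Hom C K E" and km: "is_mono C k" and ek: "eps C U A \<cdot> k = zero K A"
    using kernel_props[OF k_ker ep] by (auto simp: K_def)
  have K: "K \<in> Obj C" using HomD[OF kH] by simp
  define t T s S where "t = tr K" and "T = Dom C t" and "s = tr2 K" and "S = Dom C s"
  have t: "is_mono C t" "t \<in> Hom C T K" using trace_mono trace_Hom K by (auto simp: t_def T_def)
  have s: "is_mono C s" "s \<in> Hom C S K" using trace2_mono trace2_Hom K by (auto simp: s_def S_def)
  obtain i where i: "i \<in> Hom C T S" "s \<cdot> i = t"
    using trace_le_trace2[OF K] unfolding t_def T_def s_def S_def by blast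
  have \<tau>_def': "\<tau> = k \<cdot> t" and \<tau>2_def': "\<tau>2 = k \<cdot> s"
    by (simp_all add: \<tau>_def \<tau>2_def tr_Ker_eps_def tr2_Ker_eps_def k_def t_def s_def K_def)
  have N_def': "N = quot C s" by (simp add: N_def s_def K_def k_def)
  have \<tau>: "\<tau> \<in> Hom C T E" "is_mono C \<tau>"
    using Comp_Hom[OF t(2) kH] mono_comp[OF t(1) km t(2) kH] by (simp_all add: \<tau>_def')
  have \<tau>2: "\<tau>2 \<in> Hom C S E" "is_mono C \<tau>2"
    using Comp_Hom[OF s(2) kH] mono_comp[OF s(1) km s(2) kH] by (simp_all add: \<tau>2_def')
  have \<tau>2i: "\<tau>2 \<cdot> i = \<tau>" using Comp_assoc[OF i(1) s(2) kH] i(2) by (simp add: \<tau>_def' \<tau>2_def')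
  define p q1 q2 p2 \<pi> where "p = coker C t" and "q1 = coker C \<tau>" and "q2 = coker C \<tau>2"
    and "p2 = coker C s" and "\<pi> = coker C i"
  define P Q where "P = quot C t" and "Q = quot C i"
  have p: "is_cokernel C t p" "p \<in> Hom C K P" "is_epi C p"
    using is_cokernel_coker[OF HomD(1)] coker_Hom coker_epi t(2) by (auto simp: p_def P_def)
  have q1: "is_cokernel C \<tau> q1" "q1 \<in> Hom C E W" "is_epi C q1"
    using is_cokernel_coker[OF HomD(1)] coker_Hom coker_epi \<tau>(1) by (auto simp: q1_def W_def)
  have q2: "is_cokernel C \<tau>2 q2" "q2 \<in> Hom C E V" "is_epi C q2"
    using is_cokernel_coker[OF HomD(1)] coker_Hom coker_epi \<tau>2(1) by (auto simp: q2_def V_def)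
  have p2: "is_cokernel C s p2" "p2 \<in> Hom C K N" "is_epi C p2"
    using is_cokernel_coker[OF HomD(1)] coker_Hom coker_epi s(2) by (auto simp: p2_def N_def')
  have \<pi>: "is_cokernel C i \<pi>" "\<pi> \<in> Hom C S Q" "is_epi C \<pi>"
    using is_cokernel_coker[OF HomD(1)] coker_Hom coker_epi i(1) by (auto simp: \<pi>_def Q_def)
  have q1\<tau>: "q1 \<cdot> \<tau> = zero T W" using cokernel_zero[OF q1(1) \<tau>(1)] HomD[OF q1(2)] by simp
  have q2\<tau>2: "q2 \<cdot> \<tau>2 = zero S V" using cokernel_zero[OF q2(1) \<tau>2(1)] HomD[OF q2(2)] by simp
  have e\<tau>: "eps C U A \<cdot> \<tau> = zero T A"
    using Comp_assoc[OF t(2) kH ep] ek zero_comp[OF t(2) A] by (simp add: \<tau>_def')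
  have e\<tau>2: "eps C U A \<cdot> \<tau>2 = zero S A"
    using Comp_assoc[OF s(2) kH ep] ek zero_comp[OF s(2) A] by (simp add: \<tau>2_def')
  have q2\<tau>: "q2 \<cdot> \<tau> = zero T V"
    using Comp_assoc[OF i(1) \<tau>2(1) q2(2)] \<tau>2i q2\<tau>2 zero_comp[OF i(1)] HomD[OF q2(2)] by simp
  obtain r where r: "r \<in> Hom C W V" "r \<cdot> q1 = q2"
    using cokernel_factor[OF q1(1) \<tau>(1) q1(2) q2(2) q2\<tau>] .
  obtain a where a: "a \<in> Hom C W A" "a \<cdot> q1 = eps C U A"
    using cokernel_factor[OF q1(1) \<tau>(1) q1(2) ep e\<tau>] .
  obtain b where b: "b \<in> Hom C V A" "b \<cdot> q2 = eps C U A"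
    using cokernel_factor[OF q2(1) \<tau>2(1) q2(2) ep e\<tau>2] .
  have br: "b \<cdot> r = a"
    using epiD[OF q1(3,2) Comp_Hom[OF r(1) b(1)] a(1)] Comp_assoc[OF q1(2) r(1) b(1)] r a b by simp
  have r_epi: "is_epi C r" using epi_cancel[OF _ q1(2) r(1)] r(2) q2(3) by simp
  have H: "H \<in> Hom C Q W" "H \<cdot> \<pi> = q1 \<cdot> \<tau>2"
    using quot_sub_props[OF \<tau>2(2,1) i(1) \<tau>2i] by (simp_all add: H_def Q_def W_def \<pi>_def q1_def)
  \<comment> \<open>\<open>\<tau>2\<close> is regarded as the kernel of its own cokernel
    \<open>q2\<close>, which brings \<open>r\<close> into the scope of
    \<open>kernel_on_quotient\<close>.\<close>
  have H_ker: "is_kernel C r H"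
    using kernel_on_quotient[OF \<tau>(2,1) q1(1,2) mono_kernel_of_cokernel[OF \<tau>2(2,1) q2(1)] q2(2) \<tau>2(1)
        r i(1) \<tau>2i \<pi>(1,2) H] .
  have rH: "r \<cdot> H = zero Q V" using kernel_zero[OF H_ker r(1)] HomD[OF H(1)] by simp
  note H_coker = epi_cokernel_of_kernel[OF r_epi r(1) H_ker]
  have "q2 \<cdot> k \<cdot> s = zero S V" using Comp_assoc[OF s(2) kH q2(2)] q2\<tau>2 by (simp add: \<tau>2_def')
  then obtain n where n: "n \<in> Hom C N V" "n \<cdot> p2 = q2 \<cdot> k"
    using cokernel_factor[OF p2(1) s(2) p2(2) Comp_Hom[OF kH q2(2)]] by blast
  have n_ker: "is_kernel C b n"
    using kernel_on_quotient[OF \<tau>2(2,1) q2(1,2) k_ker ep kH b s(2) \<tau>2_def'[symmetric] p2(1,2) n] .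
  have "q1 \<cdot> k \<cdot> t = zero T W" using Comp_assoc[OF t(2) kH q1(2)] q1\<tau> by (simp add: \<tau>_def')
  then obtain m where m: "m \<in> Hom C P W" "m \<cdot> p = q1 \<cdot> k"
    using cokernel_factor[OF p(1) t(2) p(2) Comp_Hom[OF kH q1(2)]] by blast
  have m_ker: "is_kernel C a m"
    using kernel_on_quotient[OF \<tau>(2,1) q1(1,2) k_ker ep kH a t(2) \<tau>_def'[symmetric] p(1,2) m] .
  define h where "h = quot_sub C t s"
  have h: "h \<in> Hom C Q P" "h \<cdot> \<pi> = p \<cdot> s"
    using quot_sub_props[OF s(1,2) i] by (simp_all add: h_def Q_def P_def \<pi>_def p_def)
  \<comment> \<open>The definition of \<open>tr\<^sup>2\<close> speaks of a subobject
    \<open>h\<close> of \<open>P = K/tr(K)\<close>, whereas \<open>H\<close> lands in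
    \<open>W\<close>. The inclusion \<open>m\<close> of \<open>P\<close> as \<open>Ker a\<close>
    connects the two.\<close>
  have mh: "m \<cdot> h = H"
  proof (rule epiD[OF \<pi>(3,2) Comp_Hom[OF h(1) m(1)] H(1)])
    show "m \<cdot> h \<cdot> \<pi> = H \<cdot> \<pi>"
      using Comp_assoc[OF \<pi>(2) h(1) m(1)] h H Comp_assoc[OF s(2) p(2) m(1)] m
        Comp_assoc[OF s(2) kH q1(2)] by (simp add: \<tau>2_def')
  qed
  have P: "P \<in> Obj C" using HomD[OF p(2)] by simp
  define \<rho> R where "\<rho> = tr P" and "R = Dom C \<rho>"
  have \<rho>: "\<rho> \<in> Hom C R P" "is_mono C \<rho>" using trace_Hom trace_mono P by (auto simp: \<rho>_def R_def)
  have "sub_eq C h \<rho>" using trace2_quot[OF K] by (simp add: h_def t_def s_def \<rho>_def P_def)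
  then obtain w z where w: "w \<in> Hom C Q R" "\<rho> \<cdot> w = h" and z: "z \<in> Hom C R Q" "h \<cdot> z = \<rho>"
    unfolding sub_eq_def sub_le_def HomD(2)[OF h(1)] HomD(2)[OF \<rho>(1)] by blast
  \<comment> \<open>Such a \<open>y\<close> factors through \<open>Ker a = P\<close>, and then
    through the trace of \<open>P\<close> because its source is in \<open>Sum\<close>. That trace is
    \<open>h\<close> as a subobject, so \<open>y\<close> factors through
    \<open>H = Ker r\<close>.\<close>
  have kill: "r \<cdot> y = zero Y V" if Y: "Y \<in> Sum \<kappa> C U" and y: "y \<in> Hom C Y W" "a \<cdot> y = zero Y A" for Y y
  proof -
    obtain y' where y': "y' \<in> Hom C Y P" "m \<cdot> y' = y"
      using kernel_factor[OF m_ker a(1) m(1) y] .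
    obtain y'' where y'': "y'' \<in> Hom C Y R" "\<rho> \<cdot> y'' = y'"
      using trace_factor[OF Y y'(1)] unfolding \<rho>_def R_def .
    have zy: "z \<cdot> y'' \<in> Hom C Y Q" using Comp_Hom[OF y''(1) z(1)] .
    have "y = H \<cdot> (z \<cdot> y'')"
      using Comp_assoc[OF zy h(1) m(1)] mh Comp_assoc[OF y''(1) z(1) h(1)] z y' y'' by simp
    then show ?thesis
      using Comp_assoc[OF zy H(1) r(1)] rH zero_comp[OF zy] HomD[OF r(1)] by simp
  qed
  \<comment> \<open>The lift \<open>y\<close> through \<open>eps\<close> need not respect the
    relation \<open>f\<close>. But \<open>y \<cdot> f\<close> lands in \<open>K\<close> and starts
    in \<open>Sum\<close>, so it factors through \<open>tr(K)\<close>, which \<open>q1\<close>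
    kills; thus \<open>q1 \<cdot> y\<close> descends to \<open>X\<close>.\<close>
  have lift: "\<exists>x'\<in>Hom C X W. a \<cdot> x' = x" if X: "X \<in> Pres \<kappa> C U" and x: "x \<in> Hom C X A" for X x
  proof -
    obtain f Y' Y c where f: "f \<in> Hom C Y' Y" and Y': "Y' \<in> Sum \<kappa> C U" and Y: "Y \<in> Sum \<kappa> C U"
      and c: "is_cokernel C f c" "c \<in> Hom C Y X" using PresE[OF X] .
    obtain y where y: "y \<in> Hom C Y E" "eps C U A \<cdot> y = x \<cdot> c"
      using eps_lift[OF Y Comp_Hom[OF c(2) x]] unfolding E_def .
    have "eps C U A \<cdot> (y \<cdot> f) = x \<cdot> (c \<cdot> f)"
      using Comp_assoc[OF f y(1) ep] y(2) Comp_assoc[OF f c(2) x] by simp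
    then have "eps C U A \<cdot> (y \<cdot> f) = zero Y' A"
      using cokernel_zero[OF c(1) f] HomD[OF c(2)] HomD[OF f] comp_zero[OF x] by simp
    then obtain u where u: "u \<in> Hom C Y' K" "k \<cdot> u = y \<cdot> f"
      using kernel_factor[OF k_ker ep kH Comp_Hom[OF f y(1)]] by blast
    obtain u' where u': "u' \<in> Hom C Y' T" "t \<cdot> u' = u"
      using trace_factor[OF Y' u(1)] unfolding t_def T_def .
    have "y \<cdot> f = \<tau> \<cdot> u'" using Comp_assoc[OF u'(1) t(2) kH] u u' by (simp add: \<tau>_def')
    then have "q1 \<cdot> y \<cdot> f = zero Y' W"
      using Comp_assoc[OF f y(1) q1(2)] Comp_assoc[OF u'(1) \<tau>(1) q1(2)] q1\<tau> zero_comp[OF u'(1)]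
        HomD[OF q1(2)] by simp
    then obtain x' where x': "x' \<in> Hom C X W" "x' \<cdot> c = q1 \<cdot> y"
      using cokernel_factor[OF c(1) f c(2) Comp_Hom[OF y(1) q1(2)]] by blast
    have "a \<cdot> x' = x"
    proof (rule epiD[OF cokernel_epi[OF c(1) f] c(2) Comp_Hom[OF x'(1) a(1)] x])
      show "a \<cdot> x' \<cdot> c = x \<cdot> c"
        using Comp_assoc[OF c(2) x'(1) a(1)] x' Comp_assoc[OF y(1) q1(2) a(1)] a y by simp
    qed
    then show ?thesis using x'(1) by blast
  qed
  note E_Sum = U_hat_coproduct(2)[OF A, folded E_def]
  obtain e Y where e: "e \<in> Hom C Y T" "is_epi C e" and Y: "Y \<in> Sum \<kappa> C U"
    using GenE[OF trace_Gen[OF K, folded t_def, folded T_def]] .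
  have W_Pres: "W \<in> Pres \<kappa> C U"
    using PresI[OF Comp_Hom[OF e(1) \<tau>(1)] Y E_Sum comp_epi_cokernel[OF e(2,1) \<tau>(1) q1(1)] q1(2)] .
  have W_Gen: "W \<in> Gen \<kappa> C U" using GenI[OF q1(2,3) E_Sum] .
  \<comment> \<open>\<open>Q\<close> is the trace \<open>R\<close> of \<open>P\<close> up to the
    comparison arrows \<open>w\<close> and \<open>z\<close>. Once \<open>z\<close> is known to be
    epi, a coproduct covering \<open>R\<close> also covers \<open>Q\<close>.\<close>
  have "m \<cdot> h \<cdot> (z \<cdot> w) = m \<cdot> h \<cdot> Id C Q"
    using Comp_assoc[OF Comp_Hom[OF w(1) z(1)] h(1) m(1)] Comp_assoc[OF w(1) z(1) h(1)] z w
      Id_right[OF H(1)] mh by simp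
  then have "z \<cdot> w = Id C Q"
    using monoD[OF kernel_mono[OF H_ker r(1)] H(1) Comp_Hom[OF w(1) z(1)] Id_Hom] mh HomD[OF H(1)]
    by simp
  then have z_epi: "is_epi C z" using split_epi[OF z(1) w(1)] by simp
  obtain d Y' where d: "d \<in> Hom C Y' R" "is_epi C d" and Y': "Y' \<in> Sum \<kappa> C U"
    using GenE[OF trace_Gen[OF P, folded \<rho>_def, folded R_def]] .
  have Q_Gen: "Q \<in> Gen \<kappa> C U"
    using GenI[OF Comp_Hom[OF d(1) z(1)] epi_comp[OF d(2) z_epi d(1) z(1)] Y'] .
  show ?thesis
    using that[OF a(1) r(1) b(1) br H(1) H_ker H_coker n(1) n_ker W_Pres W_Gen Q_Gen] kill lift by blast
qed

section \<open>The implications between the conditions\<close>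

lemma Sum_Pres:
  assumes Y: "Y \<in> Sum \<kappa> C U"
  shows "Y \<in> Pres \<kappa> C U"
proof -
  have YO: "Y \<in> Obj C" using Sum_Obj[OF Y] .
  note I = Id_Hom[OF YO]
  have "is_epi C (Id C Y)" using split_epi[OF I I] Id_left[OF I] by simp
  \<comment> \<open>\<open>Y\<close> is presented by its own zero endomorphism.\<close>
  then have "is_cokernel C (zero Y Y) (Id C Y)"
  proof (rule cokernelI[OF zero_Hom[OF YO YO] I])
    show "\<exists>h\<in>Hom C Y X. h \<cdot> Id C Y = g" if "g \<in> Hom C Y X" for X g
      using that Id_right[OF that] by blast
  qed (use Id_left[OF zero_Hom[OF YO YO]] in simp)
  from PresI[OF zero_Hom[OF YO YO] Y Y this I] show ?thesis .
qed

text \<open>Since \<open>W\<close> is generated, it suffices to compare \<open>s \<cdot> r\<close> with the identity on a coproduct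
  covering \<open>W\<close>.\<close>

lemma cond2_imp_summand:
  assumes B: "closed_under_cokernels C (Pres \<kappa> C U)" and A: "A \<in> Obj C"
  shows "is_direct_summand C (quot_sub C (tr_Ker_eps \<kappa> C U A) (tr2_Ker_eps \<kappa> C U A))"
proof -
  define W V H where "W = quot C (tr_Ker_eps \<kappa> C U A)" and "V = quot C (tr2_Ker_eps \<kappa> C U A)"
    and "H = quot_sub C (tr_Ker_eps \<kappa> C U A) (tr2_Ker_eps \<kappa> C U A)"
  obtain r a b Q where a: "a \<in> Hom C W A" and r: "r \<in> Hom C W V" and b: "b \<in> Hom C V A"
    and br: "b \<cdot> r = a" and H: "H \<in> Hom C Q W" and H_ker: "is_kernel C r H"
    and H_coker: "is_cokernel C H r" and W: "W \<in> Pres \<kappa> C U" "W \<in> Gen \<kappa> C U" and Q: "Q \<in> Gen \<kappa> C U"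
    and kill: "\<forall>Y\<in>Sum \<kappa> C U. \<forall>y\<in>Hom C Y W. a \<cdot> y = zero Y A \<longrightarrow> r \<cdot> y = zero Y V"
    and lift: "\<forall>X\<in>Pres \<kappa> C U. \<forall>x\<in>Hom C X A. \<exists>x'\<in>Hom C X W. a \<cdot> x' = x"
    by (rule canonical_presentation[OF A, folded W_def V_def H_def]) (rule that; assumption)
  note r_epi = cokernel_epi[OF H_coker H]
  obtain e Y where e: "e \<in> Hom C Y Q" "is_epi C e" and Y: "Y \<in> Sum \<kappa> C U" using GenE[OF Q] .
  have He: "H \<cdot> e \<in> Hom C Y W" using Comp_Hom[OF e(1) H] .
  \<comment> \<open>\<open>V\<close> is the cokernel of \<open>H\<close>, hence of
    \<open>H \<cdot> e\<close>, whose source \<open>Y\<close> and target \<open>W\<close> are both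
    presented.\<close>
  have V: "V \<in> Pres \<kappa> C U"
    using B comp_epi_cokernel[OF e(2,1) H H_coker] HomD[OF He] HomD[OF r] W(1) Sum_Pres[OF Y]
    unfolding closed_under_cokernels_def by metis
  obtain s where s: "s \<in> Hom C V W" "a \<cdot> s = b" using lift V b by blast
  obtain d Z where d: "d \<in> Hom C Z W" "is_epi C d" and Z: "Z \<in> Sum \<kappa> C U" using GenE[OF W(2)] .
  have rd: "r \<cdot> d \<in> Hom C Z V" and srd: "s \<cdot> (r \<cdot> d) \<in> Hom C Z W"
    using Comp_Hom[OF d(1) r] Comp_Hom[OF Comp_Hom[OF d(1) r] s(1)] .
  have "a \<cdot> (s \<cdot> (r \<cdot> d)) = a \<cdot> d"
    using Comp_assoc[OF rd s(1) a] Comp_assoc[OF d(1) r b] s br by simp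
  then have "a \<cdot> diff (s \<cdot> (r \<cdot> d)) d = zero Z A"
    using comp_diff[OF srd d(1) a] diff_eq_zero_iff Comp_Hom[OF d(1) a] by simp
  then have "r \<cdot> diff (s \<cdot> (r \<cdot> d)) d = zero Z V"
    using kill[rule_format, OF Z diff_Hom[OF srd d(1)]] by simp
  then have "r \<cdot> (s \<cdot> (r \<cdot> d)) = r \<cdot> d"
    using comp_diff[OF srd d(1) r] diff_eq_zero_iff[OF Comp_Hom[OF srd r] rd] by simp
  then have "r \<cdot> s \<cdot> (r \<cdot> d) = Id C V \<cdot> (r \<cdot> d)"
    using Comp_assoc[OF rd s(1) r] Id_left[OF rd] by simp
  then have "r \<cdot> s = Id C V"
    using epiD[OF epi_comp[OF d(2) r_epi d(1) r] rd Comp_Hom[OF s(1) r] Id_Hom] HomD[OF r] by simp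
  then have "is_direct_summand C H" using summandI[OF H_ker H r s(1)] by simp
  then show ?thesis by (simp add: H_def)
qed

text \<open>A retraction of \<open>H\<close> yields a section \<open>s\<close> of \<open>r\<close>
  that exhibits \<open>V\<close> as a summand of \<open>W\<close>. For the vanishing,
  \<open>s\<close> carries \<open>n \<cdot> x\<close> back to \<open>W\<close>, where
  \<open>a\<close> kills it because \<open>a \<cdot> s = b\<close>. Then \<open>r\<close> kills it
  too, as its source is in \<open>Sum\<close>; but \<open>r\<close> returns
  \<open>n \<cdot> x\<close>.\<close>

lemma cond3_imp_cond4:
  assumes B: "closed_under_summands C (Pres \<kappa> C U)" and A: "A \<in> Obj C"
    and summand: "is_direct_summand C (quot_sub C (tr_Ker_eps \<kappa> C U A) (tr2_Ker_eps \<kappa> C U A))"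
  shows "quot C (tr2_Ker_eps \<kappa> C U A) \<in> Pres \<kappa> C U"
    and "X \<in> U \<Longrightarrow> x \<in> Hom C X (quot C (tr2 (Dom C (ker C (eps C U A))))) \<Longrightarrow> is_zero_arrow C x"
proof -
  define W V H N where "W = quot C (tr_Ker_eps \<kappa> C U A)" and "V = quot C (tr2_Ker_eps \<kappa> C U A)"
    and "H = quot_sub C (tr_Ker_eps \<kappa> C U A) (tr2_Ker_eps \<kappa> C U A)"
    and "N = quot C (tr2 (Dom C (ker C (eps C U A))))"
  obtain r a b n Q where a: "a \<in> Hom C W A" and r: "r \<in> Hom C W V" and b: "b \<in> Hom C V A"
    and br: "b \<cdot> r = a" and H: "H \<in> Hom C Q W"
    and H_coker: "is_cokernel C H r" and W: "W \<in> Pres \<kappa> C U"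
    and n: "n \<in> Hom C N V" "is_kernel C b n"
    and kill: "\<forall>Y\<in>Sum \<kappa> C U. \<forall>y\<in>Hom C Y W. a \<cdot> y = zero Y A \<longrightarrow> r \<cdot> y = zero Y V"
    by (rule canonical_presentation[OF A, folded W_def V_def H_def N_def]) (rule that; assumption)
  obtain w where w: "w \<in> Hom C W Q" "w \<cdot> H = Id C Q"
    using summand_retraction[OF summand[folded H_def] H] .
  obtain s where s: "s \<in> Hom C V W" "r \<cdot> s = Id C V" "is_direct_summand C s"
    using summand_complement[OF H_coker r H w] .
  have "V \<in> Pres \<kappa> C U"
    using B W s(3) HomD[OF s(1)] unfolding closed_under_summands_def by metis
  then show "quot C (tr2_Ker_eps \<kappa> C U A) \<in> Pres \<kappa> C U" by (simp add: V_def)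
  assume X: "X \<in> U" and "x \<in> Hom C X (quot C (tr2 (Dom C (ker C (eps C U A)))))"
  then have x: "x \<in> Hom C X N" by (simp add: N_def)
  have nx: "n \<cdot> x \<in> Hom C X V" using Comp_Hom[OF x n(1)] .
  have bnx: "b \<cdot> (n \<cdot> x) = zero X A"
    using Comp_assoc[OF x n(1) b] kernel_zero[OF n(2) b] HomD[OF n(1)] zero_comp[OF x A] by simp
  have rsnx: "r \<cdot> (s \<cdot> (n \<cdot> x)) = n \<cdot> x"
    using Comp_assoc[OF nx s(1) r] s Id_left[OF nx] by simp
  have snx: "s \<cdot> (n \<cdot> x) \<in> Hom C X W" using Comp_Hom[OF nx s(1)] .
  have "a \<cdot> (s \<cdot> (n \<cdot> x)) = zero X A"
    using Comp_assoc[OF snx r b] br rsnx bnx by simp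
  then have "n \<cdot> x = zero X V" using kill[rule_format, OF U_Sum[OF X] snx] rsnx by simp
  then have "x = zero X N" using mono_zeroD[OF kernel_mono[OF n(2) b] n(1) x] by simp
  then show "is_zero_arrow C x" using is_zero_arrow_iff[OF x] by simp
qed

text \<open>Existence comes from lifting to \<open>W\<close> and composing with \<open>r\<close>.
  For uniqueness, the difference of two lifts factors through \<open>Ker b\<close>, which is
  \<open>K/tr\<^sup>2(K)\<close>.\<close>

lemma cond4_imp_coreflection:
  assumes A: "A \<in> Obj C" and V_Pres: "quot C (tr2_Ker_eps \<kappa> C U A) \<in> Pres \<kappa> C U"
    and zero: "\<And>X x. X \<in> U \<Longrightarrow> x \<in> Hom C X (quot C (tr2 (Dom C (ker C (eps C U A))))) \<Longrightarrow>
      is_zero_arrow C x"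
  shows "\<exists>b. coreflection (Pres \<kappa> C U) A (quot C (tr2_Ker_eps \<kappa> C U A)) b"
proof -
  define W V H N where "W = quot C (tr_Ker_eps \<kappa> C U A)" and "V = quot C (tr2_Ker_eps \<kappa> C U A)"
    and "H = quot_sub C (tr_Ker_eps \<kappa> C U A) (tr2_Ker_eps \<kappa> C U A)"
    and "N = quot C (tr2 (Dom C (ker C (eps C U A))))"
  obtain r a b n where a: "a \<in> Hom C W A" and r: "r \<in> Hom C W V" and b: "b \<in> Hom C V A"
    and br: "b \<cdot> r = a" and n: "n \<in> Hom C N V" "is_kernel C b n"
    and lift: "\<forall>X\<in>Pres \<kappa> C U. \<forall>x\<in>Hom C X A. \<exists>x'\<in>Hom C X W. a \<cdot> x' = x"
    by (rule canonical_presentation[OF A, folded W_def V_def H_def N_def]) (rule that; assumption)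
  have unique: "x = y" if X: "X \<in> Pres \<kappa> C U" and x: "x \<in> Hom C X V" and y: "y \<in> Hom C X V"
    and xy: "b \<cdot> x = b \<cdot> y" for X x y
  proof -
    obtain f Y' Y c where f: "f \<in> Hom C Y' Y" and Y: "Y \<in> Sum \<kappa> C U"
      and c: "is_cokernel C f c" "c \<in> Hom C Y X" using PresE[OF X] .
    obtain I :: "'k set" and D j where D: "\<And>i. i \<in> I \<Longrightarrow> D i \<in> U" and cop: "is_coproduct C I D Y j"
      using Y unfolding Sum_def by blast
    have "b \<cdot> diff x y = zero X A"
      using comp_diff[OF x y b] diff_eq_zero_iff Comp_Hom[OF x b] Comp_Hom[OF y b] xy by simp
    then obtain u where u: "u \<in> Hom C X N" "n \<cdot> u = diff x y"
      using kernel_factor[OF n(2) b n(1) diff_Hom[OF x y]] by blast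
    have uc: "u \<cdot> c \<in> Hom C Y N" using Comp_Hom[OF c(2) u(1)] .
    \<comment> \<open>The hypothesis tests only objects of \<open>U\<close>. It reaches
      \<open>X\<close> through the components of a coproduct \<open>Y\<close> covering
      \<open>X\<close>.\<close>
    have "u \<cdot> c = zero Y N"
    proof (rule coproduct_unique[OF cop uc zero_Hom])
      fix i assume i: "i \<in> I"
      note ji = coproduct_inj[OF cop i]
      have ucj: "u \<cdot> c \<cdot> j i \<in> Hom C (D i) N" using Comp_Hom[OF ji uc] .
      then have "u \<cdot> c \<cdot> j i = zero (D i) N"
        using is_zero_arrow_iff[OF ucj] zero[OF D[OF i]] unfolding N_def by blast
      then show "u \<cdot> c \<cdot> j i = zero Y N \<cdot> j i" using zero_comp[OF ji] HomD[OF u(1)] by simp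
    qed (use HomD[OF uc] in auto)
    then have "u = zero X N" using epi_zeroD[OF cokernel_epi[OF c(1) f] c(2) u(1)] by simp
    then have "diff x y = zero X V" using u(2) comp_zero[OF n(1)] HomD[OF u(1)] by simp
    then show ?thesis using diff_eq_zero_iff[OF x y] by simp
  qed
  have "\<exists>!g'. g' \<in> Hom C X V \<and> b \<cdot> g' = g" if X: "X \<in> Pres \<kappa> C U" and g: "g \<in> Hom C X A" for X g
  proof -
    obtain x where x: "x \<in> Hom C X W" "a \<cdot> x = g" using lift X g by blast
    have rx: "r \<cdot> x \<in> Hom C X V" "b \<cdot> (r \<cdot> x) = g"
      using Comp_Hom[OF x(1) r] Comp_assoc[OF x(1) r b] br x by simp_all
    show ?thesis
    proof (rule ex1I[of _ "r \<cdot> x"])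
      show "y = r \<cdot> x" if "y \<in> Hom C X V \<and> b \<cdot> y = g" for y
        by (rule unique[OF X _ rx(1)]) (use that rx(2) in simp_all)
    qed (use rx in simp)
  qed
  then have "coreflection (Pres \<kappa> C U) A V b"
    unfolding coreflection_def using V_Pres b by (simp add: V_def)
  then show ?thesis unfolding V_def by blast
qed

end

theorem theorem8p5:
  fixes \<kappa> :: "'k rel" and C :: "('o, 'a) cat" and U :: "'o set"
  assumes "Cinfinite \<kappa>" and "regularCard \<kappa>"
    and "locally_small \<kappa> C" and "AB3_abelian \<kappa> C"
    and "U \<subseteq> Obj C" and "small \<kappa> U"
  defines "B \<equiv> Pres \<kappa> C U"
  defines "cond1 \<equiv> coreflective C B"
    and "cond2 \<equiv> closed_under_cokernels C B"
    and "cond3 \<equiv> closed_under_summands C B \<and>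
      (\<forall>A\<in>Obj C. is_direct_summand C
        (quot_sub C (tr_Ker_eps \<kappa> C U A) (tr2_Ker_eps \<kappa> C U A)))"
    and "cond4 \<equiv> \<forall>A\<in>Obj C.
      quot C (tr2_Ker_eps \<kappa> C U A) \<in> B \<and>
      (\<forall>X\<in>U. \<forall>f\<in>Hom C X (quot C (trace2 \<kappa> C U (Dom C (ker C (eps C U A))))).
        is_zero_arrow C f)"
  shows "(cond1 \<longleftrightarrow> cond2) \<and> (cond1 \<longleftrightarrow> cond3) \<and> (cond1 \<longleftrightarrow> cond4) \<and>
    (cond1 \<longrightarrow> (\<exists>q. right_adjoint (full_subcat C B) C inclusion q \<and>
      (\<forall>A\<in>Obj C. OMap q A = quot C (tr2_Ker_eps \<kappa> C U A)) \<and>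
      (\<forall>q'. right_adjoint (full_subcat C B) C inclusion q' \<longrightarrow>
        naturally_isomorphic C (full_subcat C B) q' q)))"
proof -
  \<comment> \<open>The additive structure is only asserted to exist, and none of the conditions
    mentions it, so any choice may be fixed.\<close>
  obtain add zero where abelian: "abelian_category C add zero" and cocomplete: "cocomplete \<kappa> C"
    using \<open>AB3_abelian \<kappa> C\<close> unfolding AB3_abelian_def abelian_def by blast
  interpret abelian_category C add zero by (fact abelian)
  interpret AB3_category C add zero \<kappa> U
    by unfold_locales (fact assms cocomplete)+
  have B_sub: "is_subcategory C B" unfolding B_def by (rule is_subcategory_Pres)
  then have B_Obj: "B \<subseteq> Obj C" unfolding is_subcategory_def by simp
  have 12: "cond1 \<Longrightarrow> cond2"
    unfolding cond1_def cond2_def by (rule coreflective_closed_under_cokernels)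
  have 23: "cond2 \<Longrightarrow> cond3"
    unfolding cond2_def cond3_def B_def
    using closed_under_cokernels_summands cond2_imp_summand by blast
  have 34: "cond3 \<Longrightarrow> cond4"
    unfolding cond3_def cond4_def B_def using cond3_imp_cond4 by blast
  \<comment> \<open>Under (4) the coreflections sit on the prescribed quotients, so the adjoint
    assembled from them has the stated values exactly. Natural isomorphism enters only when another
    right adjoint is compared with it.\<close>
  have adjoint: "\<exists>q. right_adjoint (full_subcat C B) C inclusion q \<and>
      (\<forall>A\<in>Obj C. OMap q A = quot C (tr2_Ker_eps \<kappa> C U A))" if cond4
  proof -
    have "\<forall>A\<in>Obj C. \<exists>b. coreflection B A (quot C (tr2_Ker_eps \<kappa> C U A)) b"
      using that cond4_imp_coreflection unfolding cond4_def B_def by blast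
    then obtain b where "\<And>A. A \<in> Obj C \<Longrightarrow> coreflection B A (quot C (tr2_Ker_eps \<kappa> C U A)) (b A)"
      by metis
    from right_adjoint_of_coreflections[OF B_Obj this] show ?thesis by blast
  qed
  have 41: "cond4 \<Longrightarrow> cond1"
    using adjoint B_sub unfolding cond1_def coreflective_def by blast
  have "\<exists>q. right_adjoint (full_subcat C B) C inclusion q \<and>
      (\<forall>A\<in>Obj C. OMap q A = quot C (tr2_Ker_eps \<kappa> C U A)) \<and>
      (\<forall>q'. right_adjoint (full_subcat C B) C inclusion q' \<longrightarrow>
        naturally_isomorphic C (full_subcat C B) q' q)" if cond1
    using adjoint[OF 34[OF 23[OF 12[OF that]]]] right_adjoint_unique[OF B_Obj] by blast
  with 12 23 34 41 show ?thesis by blast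
qed

end
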